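(* Let $F$ be a bivariate distribution function whose marginals $F_1$ and $F_2$ have support bounded from below. Then $F$ is bi-freely max-infinitely divisible if and only if there exist a copula $D$ and a number $\theta\in(0,1]$ such that $$F(x_1,x_2)=\frac{\theta F_1(x_1)F_2(x_2)}{\theta-D\big(\theta(1-F_1(x_1)),\,\theta(1-F_2(x_2))\big)},\qquad (x_1,x_2)\in\mathbb{R}^2,$$ where the right-hand side is understood to be $0$ wherever $F_1(x_1)F_2(x_2)=0$.
   Context: A bivariate distribution function is $F(x_1,x_2)=\mu((-\infty,x_1]\times(-\infty,x_2])$ for a Borel probability measure $\mu$ on $\mathbb{R}^2$; $F_1,F_2$ denote its marginal distribution functions. A univariate distribution function $F_j$ has support bounded from below if $\{F_j>0\}\subset[L_j,\infty)$ for some $L_j\in\mathbb{R}$. $c_+=\max\{c,0\}$. Bi-free max-convolution: for bivariate distribution functions $F,G$, $H=F\star G$ is the (unique) bivariate distribution function with marginals $H_j=(F_j+G_j-1)_+$ on $\mathbb{R}$, $j=1,2$, and such that $\frac{H_1H_2}{H}=\frac{F_1F_2}{F}+\frac{G_1G_2}{G}-1$ at each $\mathbf{x}$ where $F(\mathbf{x}),G(\mathbf{x}),H_1(x_1),H_2(x_2)$ are all strictly positive, and $H(\mathbf{x})=0$ at all other $\mathbf{x}$. The operation is well defined, commutative and associative; $F^{\star n}$ is the $n$-fold convolution of $F$ with itself. $F$ is bi-freely max-infinitely divisible if for every $n\in\mathbb{N}$ there is a bivariate distribution function $F^{(1/n)}$ with $(F^{(1/n)})^{\star n}=F$. A (bivariate)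 copula is a function $C:[0,1]^2\to[0,1]$ with $C(0,\cdot)\equiv0\equiv C(\cdot,0)$, $C(u,1)=u$, $C(1,v)=v$ for all $u,v\in[0,1]$, and $C(u_2,v_2)-C(u_1,v_2)-C(u_2,v_1)+C(u_1,v_1)\ge0$ whenever $u_1\le u_2$, $v_1\le v_2$. *)

theory Defs
  imports "HOL-Probability.Probability"
begin

definition bdf_of :: "(real \<times> real) measure \<Rightarrow> real \<Rightarrow> real \<Rightarrow> real" where
  "bdf_of M x1 x2 = measure M ({..x1} \<times> {..x2})"

definition bivariate_df :: "(real \<Rightarrow> real \<Rightarrow> real) \<Rightarrow> bool" where
  "bivariate_df F \<longleftrightarrow>
     (\<exists>M. prob_space M \<and> sets M = sets (borel :: (real \<times> real) measure) \<and> F = bdf_of M)"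

text \<open>The marginals are read off from the function itself, as $F(x,\infty)$ and $F(\infty,x)$;
  the lemma \<open>marginal_bdf_of\<close> below identifies them with the distribution functions of the
  marginal laws.\<close>

definition marginal1 :: "(real \<Rightarrow> real \<Rightarrow> real) \<Rightarrow> real \<Rightarrow> real" where
  "marginal1 F x1 = Lim at_top (\<lambda>x2. F x1 x2)"

definition marginal2 :: "(real \<Rightarrow> real \<Rightarrow> real) \<Rightarrow> real \<Rightarrow> real" where
  "marginal2 F x2 = Lim at_top (\<lambda>x1. F x1 x2)"

definition support_bdd_below :: "(real \<Rightarrow> real) \<Rightarrow> bool" where
  "support_bdd_below f \<longleftrightarrow> (\<exists>L. {x. f x > 0} \<subseteq> {L..})"

text \<open>\<open>bifree_max_conv F G H\<close> says that \<open>H\<close> is the bi-free max-convolution of \<open>F\<close> and \<open>G\<close>.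
  It is a relation, so that no choice of value is needed; it is single-valued by
  \<open>bifree_max_conv_unique\<close>. In the quotient equation \<open>H x1 x2\<close> cannot vanish, since the
  right-hand side is at least $H_1(x_1) > 0$; hence division by zero plays no role.\<close>

definition bifree_max_conv ::
  "(real \<Rightarrow> real \<Rightarrow> real) \<Rightarrow> (real \<Rightarrow> real \<Rightarrow> real) \<Rightarrow> (real \<Rightarrow> real \<Rightarrow> real) \<Rightarrow> bool" where
  "bifree_max_conv F G H \<longleftrightarrow>
     bivariate_df F \<and> bivariate_df G \<and> bivariate_df H \<and>
     (\<forall>x. marginal1 H x = max (marginal1 F x + marginal1 G x - 1) 0) \<and>
     (\<forall>x. marginal2 H x = max (marginal2 F x + marginal2 G x - 1) 0) \<and>
     (\<forall>x1 x2.
        if F x1 x2 > 0 \<and> G x1 x2 > 0 \<and> marginal1 H x1 > 0 \<and> marginal2 H x2 > 0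
        then marginal1 H x1 * marginal2 H x2 / H x1 x2 =
               marginal1 F x1 * marginal2 F x2 / F x1 x2 +
               marginal1 G x1 * marginal2 G x2 / G x1 x2 - 1
        else H x1 x2 = 0)"

text \<open>\<open>bifree_max_power F n H\<close> says that \<open>H\<close> is the \<open>n\<close>-fold convolution of \<open>F\<close> with itself, \<open>n \<ge> 1\<close>;
  there is no rule for \<open>n = 0\<close>.\<close>

inductive bifree_max_power ::
  "(real \<Rightarrow> real \<Rightarrow> real) \<Rightarrow> nat \<Rightarrow> (real \<Rightarrow> real \<Rightarrow> real) \<Rightarrow> bool" for F where
  one: "bivariate_df F \<Longrightarrow> bifree_max_power F 1 F"
| step: "bifree_max_power F n K \<Longrightarrow> bifree_max_conv K F H \<Longrightarrow> bifree_max_power F (Suc n) H"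

definition bifree_max_inf_divisible :: "(real \<Rightarrow> real \<Rightarrow> real) \<Rightarrow> bool" where
  "bifree_max_inf_divisible F \<longleftrightarrow>
     (\<forall>n\<ge>1. \<exists>G. bivariate_df G \<and> bifree_max_power G n F)"

text \<open>Only the values on the unit square are constrained.\<close>

definition copula :: "(real \<Rightarrow> real \<Rightarrow> real) \<Rightarrow> bool" where
  "copula C \<longleftrightarrow>
     (\<forall>u\<in>{0..1}. \<forall>v\<in>{0..1}. C u v \<in> {0..1}) \<and>
     (\<forall>v\<in>{0..1}. C 0 v = 0) \<and> (\<forall>u\<in>{0..1}. C u 0 = 0) \<and>
     (\<forall>u\<in>{0..1}. C u 1 = u) \<and> (\<forall>v\<in>{0..1}. C 1 v = v) \<and>
     (\<forall>u1\<in>{0..1}. \<forall>u2\<in>{0..1}. \<forall>v1\<in>{0..1}. \<forall>v2\<in>{0..1}.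
        u1 \<le> u2 \<longrightarrow> v1 \<le> v2 \<longrightarrow> C u2 v2 - C u1 v2 - C u2 v1 + C u1 v1 \<ge> 0)"

lemma tendsto_measure_strip:
  fixes M :: "(real \<times> real) measure" and f :: "real \<times> real \<Rightarrow> real"
  assumes "prob_space M" and S: "sets M = sets borel"
    and f: "f \<in> borel_measurable borel" and A: "A \<in> sets borel"
  shows "((\<lambda>y. measure M (A \<inter> f -` {..y})) \<longlongrightarrow> measure M A) at_top"
proof -
  interpret prob_space M by fact
  have sp: "space M = UNIV" using sets_eq_imp_space_eq[OF S] by simp
  have AM: "A \<in> sets M" using A S by simp
  let ?R = "restrict_space M A"
  let ?N = "distr ?R borel f"
  have fR: "f \<in> measurable ?R borel"
    by (intro measurable_restrict_space1) (use f measurable_cong_sets[OF S refl] in auto)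
  have "finite_measure ?R"
    using AM by (intro finite_measureI) (simp add: emeasure_restrict_space space_restrict_space sp)
  then interpret N: finite_measure ?N
    using fR by (rule finite_measure.finite_measure_distr)
  interpret N: finite_borel_measure ?N by unfold_locales simp
  have eq: "measure ?N B = measure M (A \<inter> f -` B)" if "B \<in> sets borel" for B
    using that AM by (subst measure_distr[OF fR])
      (auto simp: measure_restrict_space space_restrict_space sp Int_commute)
  have "(cdf ?N \<longlongrightarrow> measure ?N (space ?N)) at_top" by (rule N.cdf_lim_at_top)
  then show ?thesis by (simp add: cdf_def[abs_def] eq)
qed

lemma marginal_bdf_of:
  assumes M: "prob_space M" and S: "sets M = sets (borel :: (real \<times> real) measure)"
  shows "((\<lambda>x2. bdf_of M x1 x2) \<longlongrightarrow> cdf (distr M borel fst) x1) at_top"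
    and "((\<lambda>x1. bdf_of M x1 x2) \<longlongrightarrow> cdf (distr M borel snd) x2) at_top"
    and "marginal1 (bdf_of M) = cdf (distr M borel fst)"
    and "marginal2 (bdf_of M) = cdf (distr M borel snd)"
proof -
  have sp: "space M = UNIV" using sets_eq_imp_space_eq[OF S] by simp
  have m: "fst \<in> borel_measurable M" "snd \<in> borel_measurable M"
    using measurable_cong_sets[OF S refl] by (auto simp: borel_prod[symmetric])
  have b: "(fst :: real \<times> real \<Rightarrow> real) \<in> borel_measurable borel"
    "(snd :: real \<times> real \<Rightarrow> real) \<in> borel_measurable borel"
    by (auto simp: borel_prod[symmetric])
  have c: "cdf (distr M borel fst) x = measure M (fst -` {..x})"
    "cdf (distr M borel snd) x = measure M (snd -` {..x})" for x
    using m by (auto simp: cdf_def measure_distr sp)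
  have s: "fst -` {..x::real} \<in> sets (borel :: (real \<times> real) measure)"
    "snd -` {..x::real} \<in> sets (borel :: (real \<times> real) measure)" for x
    using measurable_sets[OF b(1), of "{..x}"] measurable_sets[OF b(2), of "{..x}"] by auto
  have e: "{..x} \<times> {..y} = fst -` {..x} \<inter> snd -` {..y}"
    "{..x} \<times> {..y} = snd -` {..y} \<inter> fst -` {..x}" for x y :: real by auto
  show 1: "((\<lambda>x2. bdf_of M x1 x2) \<longlongrightarrow> cdf (distr M borel fst) x1) at_top" for x1
    unfolding bdf_of_def c e(1) by (rule tendsto_measure_strip[OF M S b(2) s(1)])
  show 2: "((\<lambda>x1. bdf_of M x1 x2) \<longlongrightarrow> cdf (distr M borel snd) x2) at_top" for x2
    unfolding bdf_of_def c e(2) by (rule tendsto_measure_strip[OF M S b(1) s(2)])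
  show "marginal1 (bdf_of M) = cdf (distr M borel fst)"
    using 1 by (auto simp: marginal1_def intro!: ext tendsto_Lim)
  show "marginal2 (bdf_of M) = cdf (distr M borel snd)"
    using 2 by (auto simp: marginal2_def intro!: ext tendsto_Lim)
qed

lemma bivariate_df_bounds:
  assumes "bivariate_df F"
  shows "0 \<le> F x1 x2" "F x1 x2 \<le> marginal1 F x1" "F x1 x2 \<le> marginal2 F x2"
    "marginal1 F x1 \<le> 1" "marginal2 F x2 \<le> 1"
proof -
  obtain M where M: "prob_space M" and S: "sets M = sets (borel :: (real \<times> real) measure)"
    and F: "F = bdf_of M"
    using assms unfolding bivariate_df_def by blast
  interpret prob_space M by fact
  have m: "fst \<in> borel_measurable M" "snd \<in> borel_measurable M"
    using measurable_cong_sets[OF S refl] by (auto simp: borel_prod[symmetric])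
  have sp: "space M = UNIV" using sets_eq_imp_space_eq[OF S] by simp
  have v: "fst -` {..x1} \<in> sets M" "snd -` {..x2} \<in> sets M"
    using measurable_sets[OF m(1), of "{..x1}"] measurable_sets[OF m(2), of "{..x2}"]
    by (auto simp: sp)
  have c: "marginal1 F x1 = measure M (fst -` {..x1})" "marginal2 F x2 = measure M (snd -` {..x2})"
    using m by (auto simp: F marginal_bdf_of[OF M S] cdf_def measure_distr sp)
  show "0 \<le> F x1 x2" "marginal1 F x1 \<le> 1" "marginal2 F x2 \<le> 1"
    unfolding c by (simp_all add: F bdf_of_def)
  show "F x1 x2 \<le> marginal1 F x1" "F x1 x2 \<le> marginal2 F x2"
    unfolding c by (auto simp: F bdf_of_def v intro!: finite_measure_mono)
qed

lemma bifree_max_conv_unique: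
  assumes H: "bifree_max_conv F G H" and K: "bifree_max_conv F G K"
  shows "H = K"
proof (intro ext)
  fix x1 x2
  have m: "marginal1 K x1 = marginal1 H x1" "marginal2 K x2 = marginal2 H x2"
    and m1: "marginal1 H x1 = max (marginal1 F x1 + marginal1 G x1 - 1) 0"
    using H K unfolding bifree_max_conv_def by auto
  have dF: "bivariate_df F" and dG: "bivariate_df G"
    using H unfolding bifree_max_conv_def by auto
  define r where "r = marginal1 F x1 * marginal2 F x2 / F x1 x2 +
    marginal1 G x1 * marginal2 G x2 / G x1 x2 - 1"
  define P where "P \<longleftrightarrow> F x1 x2 > 0 \<and> G x1 x2 > 0 \<and> marginal1 H x1 > 0 \<and> marginal2 H x2 > 0"
  have h: "if P then marginal1 H x1 * marginal2 H x2 / H x1 x2 = r else H x1 x2 = 0"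
    using H unfolding bifree_max_conv_def P_def r_def by blast
  have k: "if P then marginal1 H x1 * marginal2 H x2 / K x1 x2 = r else K x1 x2 = 0"
    using K unfolding bifree_max_conv_def P_def r_def m[symmetric] by blast
  show "H x1 x2 = K x1 x2"
  proof (cases P)
    case False
    then show ?thesis using h k by simp
  next
    case True
    have q: "marginal1 E x1 \<le> marginal1 E x1 * marginal2 E x2 / E x1 x2"
      if "bivariate_df E" "E x1 x2 > 0" for E
    proof -
      have "E x1 x2 \<le> marginal2 E x2" "0 \<le> marginal1 E x1"
        using bivariate_df_bounds(1-3)[OF that(1)] by (blast intro: order_trans)+
      then show ?thesis using that(2) by (simp add: pos_le_divide_eq mult_left_mono)
    qed
    have "r > 0"
      using q[OF dF] q[OF dG] m1 True unfolding r_def P_def by auto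
    moreover have "marginal1 H x1 * marginal2 H x2 / H x1 x2 = r"
      "marginal1 H x1 * marginal2 H x2 / K x1 x2 = r"
      using True h k by auto
    moreover from this \<open>r > 0\<close> have "H x1 x2 \<noteq> 0" "K x1 x2 \<noteq> 0" by auto
    ultimately show ?thesis by (auto simp: field_simps)
  qed
qed

end

theory Submission imports Defs begin

text \<open>
  Write \<open>f\<close>, \<open>g\<close> for the marginals of \<open>F\<close> and \<open>a = 1 - f(x)\<close>, \<open>b = 1 - g(y)\<close>. The \<open>n\<close>-th
  convolution power multiplies the tails \<open>a\<close>, \<open>b\<close> of a distribution function by \<open>n\<close>, and also its
  excess \<open>f(x) g(y) / F(x,y) - 1\<close>, wherever the function and the marginals of the power are positive
  (\<open>bifree_max_power_quotient\<close>). Divisibility of \<open>F\<close> thus asks that dividing all three quantities by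
  \<open>n\<close> again yields a bivariate distribution function.

  Both sides of the equivalence are compared with a third property: there is a function
  \<open>Q\<close> with \<open>1 - f(x) g(y) / F(x,y) = Q(a,b)\<close>, where \<open>Q\<close> is the distribution function of a measure on
  the unit square whose marginals are at most Lebesgue measure. Such \<open>Q\<close> are called doubly
  substochastic below. They are precisely the rescaled corners of copulas: for a copula \<open>D\<close> and
  \<open>0 < \<theta> \<le> 1\<close> the function \<open>D(\<theta>s, \<theta>t) / \<theta>\<close> is doubly substochastic, and every doubly substochastic
  function has this form with \<open>\<theta> = 1/2\<close> (\<open>doubly_substochastic_extends_to_copula\<close>), because the mass
  missing from the marginals can be spread over the other three quarters of the square.

  Suppose that \<open>F\<close> is divisible, with \<open>n\<close>-th root \<open>G\<close>. The survival copula \<open>C\<close> of \<open>G\<close> satisfies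
  \<open>G(x,y) = 1 - a/n - b/n + C(a/n, b/n)\<close>, and so
  \[ n \Big(\frac{G_1 G_2}{G} - 1\Big) = \frac{ab/n - n\,C(a/n, b/n)}{G(x,y)} . \]
  Since \<open>G(x,y)\<close> tends to 1, the doubly substochastic functions \<open>n C(s/n, t/n)\<close> converge at \<open>(a,b)\<close> to
  \<open>1 - f(x) g(y) / F(x,y)\<close>. Compactness of the set of doubly substochastic functions in the topology
  of pointwise convergence (\<open>doubly_substochastic_limit\<close>) supplies \<open>Q\<close> on the whole square.

  Conversely, given \<open>Q\<close>, consider for \<open>0 < k \<le> 1\<close>
  \[ K_k(x,y) = \frac{(1 - ka)(1 - kb)}{1 - k\,Q(a,b)} \]
  to the right of lower bounds of the two supports and 0 elsewhere. Then
  \<open>K\<^sub>1 = F\<close>, and tails and excess of \<open>K\<^sub>k\<close> are linear in \<open>k\<close>, which makes \<open>K\<close> a convolution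
  semigroup; so \<open>K\<^sub>1\<^sub>/\<^sub>n\<close> is an \<open>n\<close>-th root. That each \<open>K\<^sub>k\<close> is a bivariate distribution function
  rests on two facts: \<open>u v / (1 - R(1 - u, 1 - v))\<close> is a copula for every doubly substochastic \<open>R\<close>
  (\<open>product_over_survival_copula\<close>), and a copula composed with two distribution functions is the
  distribution function of a measure on the plane (\<open>bivariate_df_copula\<close>). The lower bounds
  of the supports carry the atoms that keep the marginals of \<open>K\<^sub>k\<close> at or above \<open>1 - k\<close> from there on.
\<close>

section \<open>Doubly substochastic functions\<close>

text \<open>These are the distribution functions of the measures on the unit square both of whose
  marginals are bounded by Lebesgue measure.\<close>

definition doubly_substochastic :: "(real \<Rightarrow> real \<Rightarrow> real) \<Rightarrow> bool" where
  "doubly_substochastic Q \<longleftrightarrow>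
     (\<forall>t\<in>{0..1}. Q 0 t = 0) \<and> (\<forall>s\<in>{0..1}. Q s 0 = 0) \<and>
     (\<forall>s\<in>{0..1}. \<forall>s'\<in>{0..1}. s \<le> s' \<longrightarrow> Q s' 1 - Q s 1 \<le> s' - s) \<and>
     (\<forall>t\<in>{0..1}. \<forall>t'\<in>{0..1}. t \<le> t' \<longrightarrow> Q 1 t' - Q 1 t \<le> t' - t) \<and>
     (\<forall>s\<in>{0..1}. \<forall>s'\<in>{0..1}. \<forall>t\<in>{0..1}. \<forall>t'\<in>{0..1}.
        s \<le> s' \<longrightarrow> t \<le> t' \<longrightarrow> Q s t' + Q s' t \<le> Q s' t' + Q s t)"

lemma doubly_substochastic_rectangle:
  assumes "doubly_substochastic Q" "0 \<le> s" "s \<le> s'" "s' \<le> 1" "0 \<le> t" "t \<le> t'" "t' \<le> 1"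
  shows "Q s t' + Q s' t \<le> Q s' t' + Q s t"
proof -
  have "s \<in> {0..1}" "s' \<in> {0..1}" "t \<in> {0..1}" "t' \<in> {0..1}" using assms by auto
  then show ?thesis using assms(1,3,6) unfolding doubly_substochastic_def by blast
qed

lemma doubly_substochastic_zero:
  assumes "doubly_substochastic Q" "0 \<le> s" "s \<le> 1"
  shows "Q 0 s = 0" "Q s 0 = 0"
  using assms unfolding doubly_substochastic_def by auto

lemma doubly_substochastic_transpose:
  assumes "doubly_substochastic Q"
  shows "doubly_substochastic (\<lambda>s t. Q t s)"
  using assms unfolding doubly_substochastic_def
  by (auto simp: algebra_simps)

text \<open>The second-order inequality, applied against the edge \<open>t = 0\<close> where \<open>Q\<close> vanishes and against the
  edge \<open>t = 1\<close> where the increments are at most \<open>s' - s\<close>, carries monotonicity and the Lipschitz bound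
  to every horizontal section.\<close>

lemma doubly_substochastic_increment1:
  assumes Q: "doubly_substochastic Q" and "0 \<le> s" "s \<le> s'" "s' \<le> 1" "0 \<le> t" "t \<le> 1"
  shows "Q s t \<le> Q s' t" "Q s' t \<le> Q s t + (s' - s)"
proof -
  have "Q s' 1 - Q s 1 \<le> s' - s"
    using assms unfolding doubly_substochastic_def by auto
  then show "Q s t \<le> Q s' t" "Q s' t \<le> Q s t + (s' - s)"
    using doubly_substochastic_rectangle[OF Q, of s s' 0 t]
      doubly_substochastic_rectangle[OF Q, of s s' t 1]
      doubly_substochastic_zero[OF Q, of s] doubly_substochastic_zero[OF Q, of s'] assms
    by auto
qed

lemmas doubly_substochastic_increment2 =
  doubly_substochastic_increment1[OF doubly_substochastic_transpose]

lemma doubly_substochastic_bounds: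
  assumes Q: "doubly_substochastic Q" and "0 \<le> s" "s \<le> 1" "0 \<le> t" "t \<le> 1"
  shows "0 \<le> Q s t" "Q s t \<le> s" "Q s t \<le> t"
  using doubly_substochastic_increment1[OF Q, of 0 s t] doubly_substochastic_increment2[OF Q, of 0 t s]
    doubly_substochastic_zero[OF Q] assms by auto

lemma copula_imp_doubly_substochastic:
  assumes "copula C" shows "doubly_substochastic C"
proof -
  have R: "C u2 v2 - C u1 v2 - C u2 v1 + C u1 v1 \<ge> 0"
    if "u1 \<in> {0..1}" "u2 \<in> {0..1}" "v1 \<in> {0..1}" "v2 \<in> {0..1}" "u1 \<le> u2" "v1 \<le> v2" for u1 u2 v1 v2
    using assms that unfolding copula_def by blast
  have "C s t' + C s' t \<le> C s' t' + C s t"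
    if "s \<in> {0..1}" "s' \<in> {0..1}" "t \<in> {0..1}" "t' \<in> {0..1}" "s \<le> s'" "t \<le> t'" for s s' t t'
    using R[OF that] by linarith
  moreover have "\<forall>t\<in>{0..1}. C 0 t = 0" "\<forall>s\<in>{0..1}. C s 0 = 0"
    "\<forall>s\<in>{0..1}. C s 1 = s" "\<forall>t\<in>{0..1}. C 1 t = t"
    using assms unfolding copula_def by simp_all
  ultimately show ?thesis unfolding doubly_substochastic_def by simp
qed

lemma copulaI:
  assumes Q: "doubly_substochastic Q"
    and "\<And>u. 0 \<le> u \<Longrightarrow> u \<le> 1 \<Longrightarrow> Q u 1 = u" "\<And>v. 0 \<le> v \<Longrightarrow> v \<le> 1 \<Longrightarrow> Q 1 v = v"
  shows "copula Q"
proof -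
  have "Q u v \<in> {0..1}" if "u \<in> {0..1}" "v \<in> {0..1}" for u v
    using doubly_substochastic_bounds[OF Q, of u v] that by auto
  moreover have "Q u2 v2 - Q u1 v2 - Q u2 v1 + Q u1 v1 \<ge> 0"
    if "u1 \<in> {0..1}" "u2 \<in> {0..1}" "v1 \<in> {0..1}" "v2 \<in> {0..1}" "u1 \<le> u2" "v1 \<le> v2" for u1 u2 v1 v2
    using doubly_substochastic_rectangle[OF Q, of u1 u2 v1 v2] that by auto
  ultimately show ?thesis
    unfolding copula_def using doubly_substochastic_zero[OF Q] assms by auto
qed

text \<open>Restricting a measure to a corner of the square and blowing the corner up by \<open>1 / k\<close>
  (or, for \<open>k > 1\<close>, shrinking the square into a corner) multiplies the density bound of the marginals
  by \<open>k\<close>; the factor \<open>c \<le> 1 / k\<close> brings it back below 1.\<close>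

lemma doubly_substochastic_rescale:
  assumes Q: "doubly_substochastic Q" and k: "0 < k" and c: "0 \<le> c" "c * k \<le> 1"
  shows "doubly_substochastic (\<lambda>s t. c * Q (min (k * s) 1) (min (k * t) 1))"
proof -
  have m: "0 \<le> min (k * s) 1" "min (k * s) 1 \<le> 1" if "0 \<le> s" for s
    using k that by auto
  have m2: "min (k * s) 1 \<le> min (k * s') 1" if "s \<le> s'" for s s'
    by (intro min.mono mult_left_mono) (use that k in auto)
  have m3: "c * (min (k * s') 1 - min (k * s) 1) \<le> s' - s" if "s \<le> s'" for s s'
  proof -
    have "min (k * s') 1 - min (k * s) 1 \<le> k * (s' - s)"
      using mult_left_mono[OF that, of k] k unfolding right_diff_distrib by linarith
    then have "c * (min (k * s') 1 - min (k * s) 1) \<le> (c * k) * (s' - s)"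
      using mult_left_mono[OF _ c(1)] by (simp add: mult.assoc)
    also have "\<dots> \<le> 1 * (s' - s)" using c that by (intro mult_right_mono) auto
    finally show ?thesis by simp
  qed
  have i1: "c * Q (min (k * s') 1) x - c * Q (min (k * s) 1) x \<le> s' - s"
    if "0 \<le> s" "s \<le> s'" "0 \<le> x" "x \<le> 1" for s s' x
  proof -
    have "c * (Q (min (k * s') 1) x - Q (min (k * s) 1) x) \<le> c * (min (k * s') 1 - min (k * s) 1)"
      using doubly_substochastic_increment1(2)[OF Q m(1) m2, of s s' x] m[of s'] that c
      by (intro mult_left_mono) auto
    then show ?thesis using m3[OF that(2)] by (simp add: algebra_simps)
  qed
  have i2: "c * Q x (min (k * s') 1) - c * Q x (min (k * s) 1) \<le> s' - s"
    if "0 \<le> s" "s \<le> s'" "0 \<le> x" "x \<le> 1" for s s' x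
  proof -
    have "c * (Q x (min (k * s') 1) - Q x (min (k * s) 1)) \<le> c * (min (k * s') 1 - min (k * s) 1)"
      using doubly_substochastic_increment2(2)[OF Q m(1) m2, of s s' x] m[of s'] that c
      by (intro mult_left_mono) auto
    then show ?thesis using m3[OF that(2)] by (simp add: algebra_simps)
  qed
  have r: "c * Q (min (k * s) 1) (min (k * t') 1) + c * Q (min (k * s') 1) (min (k * t) 1)
     \<le> c * Q (min (k * s') 1) (min (k * t') 1) + c * Q (min (k * s) 1) (min (k * t) 1)"
    if "0 \<le> s" "s \<le> s'" "0 \<le> t" "t \<le> t'" for s s' t t'
    using mult_left_mono[OF doubly_substochastic_rectangle[OF Q m(1) m2 m(2) m(1) m2 m(2)] c(1),
        of s s' t t'] that
    by (simp add: algebra_simps)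
  show ?thesis
    unfolding doubly_substochastic_def
    using i1 i2 r m k doubly_substochastic_zero[OF Q] by auto
qed

text \<open>The measure of \<open>Q\<close>, halved and shrunk into the lower left quarter, has marginals that fall
  short of Lebesgue measure on \<open>[0, 1/2]\<close>. The deficits \<open>X\<close>, \<open>Y\<close> are made up in the two adjacent
  quarters, with product measures that are uniform in the other coordinate. What
  is then missing on \<open>[1/2, 1]\<close> is uniform of total mass \<open>Q 1 1 / 2\<close> in either coordinate, and the
  uniform measure on the last quarter supplies it.\<close>

lemma doubly_substochastic_extends_to_copula:
  assumes Q: "doubly_substochastic Q"
  obtains D where "copula D" "\<And>s t. s \<in> {0..1} \<Longrightarrow> t \<in> {0..1} \<Longrightarrow> D (s / 2) (t / 2) = Q s t / 2"
proof -
  define l h :: "real \<Rightarrow> real" where "l = (\<lambda>s. min (2 * s) 1)" and "h = (\<lambda>s. max (2 * s - 1) 0)"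
  have lh: "0 \<le> l s" "l s \<le> 1" "0 \<le> h s" "h s \<le> 1" "l s + h s = 2 * s" if "0 \<le> s" "s \<le> 1" for s
    using that by (auto simp: l_def h_def)
  have mono: "l s \<le> l s'" "h s \<le> h s'" if "s \<le> s'" for s s' using that by (auto simp: l_def h_def)
  define X Y where "X = (\<lambda>s. l s - Q (l s) 1)" and "Y = (\<lambda>t. l t - Q 1 (l t))"
  define D where "D = (\<lambda>s t. (Q (l s) (l t) + h s * Y t + h t * X s + h s * h t * Q 1 1) / 2)"
  have XY: "X s \<le> X s'" "Y s \<le> Y s'" if "0 \<le> s" "s \<le> s'" "s' \<le> 1" for s s'
    using doubly_substochastic_increment1(2)[OF Q lh(1) mono(1) lh(2), of s s' 1]
      doubly_substochastic_increment2(2)[OF Q lh(1) mono(1) lh(2), of s s' 1] that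
    by (auto simp: X_def Y_def)
  have q: "0 \<le> Q 1 1" "Q 1 1 \<le> 1" using doubly_substochastic_bounds[OF Q, of 1 1] by auto
  have e: "l 0 = 0" "h 0 = 0" "l 1 = 1" "h 1 = 1" by (auto simp: l_def h_def)
  note z = doubly_substochastic_zero[OF Q]
  have b1: "D s 1 = s" if "0 \<le> s" "s \<le> 1" for s
  proof -
    have "D s 1 = (l s + h s) / 2" by (simp add: D_def e X_def Y_def algebra_simps)
    then show ?thesis using lh(5)[OF that] by simp
  qed
  have b2: "D 1 s = s" if "0 \<le> s" "s \<le> 1" for s
  proof -
    have "D 1 s = (l s + h s) / 2" by (simp add: D_def e X_def Y_def algebra_simps)
    then show ?thesis using lh(5)[OF that] by simp
  qed
  have rect: "D s t' + D s' t \<le> D s' t' + D s t"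
    if "0 \<le> s" "s \<le> s'" "s' \<le> 1" "0 \<le> t" "t \<le> t'" "t' \<le> 1" for s s' t t'
  proof -
    have "Q (l s) (l t') + Q (l s') (l t) \<le> Q (l s') (l t') + Q (l s) (l t)"
      using doubly_substochastic_rectangle[OF Q lh(1) mono(1) lh(2) lh(1) mono(1) lh(2), of s s' t t'] that
      by simp
    moreover have "0 \<le> (h s' - h s) * (Y t' - Y t)" "0 \<le> (h t' - h t) * (X s' - X s)"
      "0 \<le> (h s' - h s) * (h t' - h t) * Q 1 1"
      using XY mono that q by auto
    ultimately show ?thesis by (simp add: D_def field_simps)
  qed
  have "doubly_substochastic D"
    unfolding doubly_substochastic_def
    using rect b1 b2 z lh by (auto simp: D_def e X_def Y_def)
  then have "copula D" using b1 b2 by (rule copulaI) 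
  moreover have "D (s / 2) (t / 2) = Q s t / 2" if "s \<in> {0..1}" "t \<in> {0..1}" for s t
    using that by (simp add: D_def l_def h_def)
  ultimately show thesis by (rule that)
qed

text \<open>After cross-multiplication the difference of the two sides is a sum of two nonnegative terms: one
  from the Lipschitz bound \<open>p \<le> p' + (u' - u)\<close>, the other from \<open>p' \<le> 1 - u'\<close>.\<close>

lemma product_over_survival_mono:
  assumes R: "doubly_substochastic R"
    and uv: "0 \<le> u" "u \<le> u'" "u' \<le> 1" "0 \<le> v" "v \<le> 1"
  shows "u * v / (1 - R (1 - u) (1 - v)) \<le> u' * v / (1 - R (1 - u') (1 - v))"
proof (cases "v = 0")
  case True then show ?thesis by simp
next
  case False
  define p p' where "p = R (1 - u) (1 - v)" and "p' = R (1 - u') (1 - v)"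
  have pp: "p \<le> p' + (u' - u)"
    using doubly_substochastic_increment1(2)[OF R, of "1 - u'" "1 - u" "1 - v"] uv
    by (auto simp: p_def p'_def)
  have p'u: "p' \<le> 1 - u'"
    using doubly_substochastic_bounds(2)[OF R, of "1 - u'" "1 - v"] uv by (auto simp: p'_def)
  have pos: "0 < 1 - p" "0 < 1 - p'"
    using doubly_substochastic_bounds(3)[OF R, of "1 - u" "1 - v"]
      doubly_substochastic_bounds(3)[OF R, of "1 - u'" "1 - v"] False uv
    by (auto simp: p_def p'_def)
  have "u * (p - p') \<le> u * (u' - u)" using pp uv by (intro mult_left_mono) auto
  moreover have "0 \<le> (u' - u) * (1 - u' - p')" using p'u uv by auto
  ultimately have "u * (1 - p') \<le> u' * (1 - p)"
    using mult_nonneg_nonneg[of "u' - u" "u' - u - (p - p')"] pp uv by (simp add: algebra_simps)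
  then have "v * (u * (1 - p')) \<le> v * (u' * (1 - p))" using uv by (intro mult_left_mono) auto
  then show ?thesis
    using pos unfolding p_def[symmetric] p'_def[symmetric] by (simp add: divide_simps mult_ac)
qed

text \<open>For smooth \<open>R\<close> this is the computation \<open>W_uv = W ((log W)_u (log W)_v + (log W)_uv)\<close>, in which
  every term is nonnegative. The discrete form, which needs no derivatives, is that
  \<open>W\<close> increases in each variable and is log-supermodular; these two properties together imply that
  \<open>W\<close> is 2-increasing.\<close>

lemma product_over_survival_copula:
  assumes R: "doubly_substochastic R"
  shows "copula (\<lambda>u v. u * v / (1 - R (1 - u) (1 - v)))"
proof -
  define W where "W = (\<lambda>u v. u * v / (1 - R (1 - u) (1 - v)))"
  have pos: "0 < 1 - R (1 - u) (1 - v)" if "0 \<le> u" "u \<le> 1" "0 \<le> v" "v \<le> 1" "0 < u \<or> 0 < v" for u v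
    using doubly_substochastic_bounds[OF R, of "1 - u" "1 - v"] that by auto
  have b: "W u 1 = u" "W 1 u = u" "W u 0 = 0" "W 0 u = 0" if "0 \<le> u" "u \<le> 1" for u
    using doubly_substochastic_zero[OF R, of "1-u"] that by (auto simp: W_def)
  have Wpos: "0 < W u v" if "0 < u" "u \<le> 1" "0 < v" "v \<le> 1" for u v
    using pos[of u v] that by (simp add: W_def)
  have W0: "0 \<le> W u v" if "0 \<le> u" "u \<le> 1" "0 \<le> v" "v \<le> 1" for u v
    using Wpos[of u v] b[of u] b[of v] that by (cases "u = 0"; cases "v = 0") auto
  have mono1: "W u v \<le> W u' v" if "0 \<le> u" "u \<le> u'" "u' \<le> 1" "0 \<le> v" "v \<le> 1" for u u' v
    using product_over_survival_mono[OF R that] by (simp add: W_def)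
  have mono2: "W v u \<le> W v u'" if "0 \<le> u" "u \<le> u'" "u' \<le> 1" "0 \<le> v" "v \<le> 1" for u u' v
    using product_over_survival_mono[OF doubly_substochastic_transpose[OF R] that]
    by (simp add: W_def mult.commute)
  have rect: "W u v' + W u' v \<le> W u' v' + W u v"
    if "0 \<le> u" "u \<le> u'" "u' \<le> 1" "0 \<le> v" "v \<le> v'" "v' \<le> 1" for u u' v v'
  proof (cases "u = 0 \<or> v = 0")
    case True
    then show ?thesis using b[of u] b[of u'] b[of v] b[of v'] mono1[of u u' v'] mono2[of v v' u'] that by auto
  next
    case False
    define p00 p01 p10 p11 where "p00 = 1 - R (1 - u) (1 - v)" and "p01 = 1 - R (1 - u) (1 - v')"
      and "p10 = 1 - R (1 - u') (1 - v)" and "p11 = 1 - R (1 - u') (1 - v')"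
    note P = p00_def p01_def p10_def p11_def
    have pos: "0 < p00" "0 < p01" "0 < p10" "0 < p11"
      using pos[of u v] pos[of u v'] pos[of u' v] pos[of u' v'] False that by (auto simp: P)
    have ord: "p10 \<le> p11" "p01 \<le> p11" "p00 + p11 \<le> p01 + p10"
      using doubly_substochastic_increment1(1)[OF R, of "1 - u'" "1 - u" "1 - v'"]
        doubly_substochastic_increment2(1)[OF R, of "1 - v'" "1 - v" "1 - u'"]
        doubly_substochastic_rectangle[OF R, of "1 - u'" "1 - u" "1 - v'" "1 - v"] that
      by (auto simp: P)
    have "p11 * p00 \<le> p11 * (p01 + p10 - p11)" using ord pos by (intro mult_left_mono) auto
    also have "\<dots> \<le> p01 * p10"
      using mult_nonneg_nonneg[of "p11 - p01" "p11 - p10"] ord by (simp add: algebra_simps)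
    finally have le: "p11 * p00 \<le> p01 * p10" .
    have We: "W u v = u * v / p00" "W u v' = u * v' / p01" "W u' v = u' * v / p10" "W u' v' = u' * v' / p11"
      by (auto simp: W_def P)
    have "W u v' * W u' v = (u * v * u' * v') / (p01 * p10)" by (simp add: We mult_ac)
    also have "\<dots> \<le> (u * v * u' * v') / (p11 * p00)"
      using le pos that by (intro divide_left_mono) auto
    also have "\<dots> = W u' v' * W u v" by (simp add: We mult_ac)
    finally have tp2: "W u v' * W u' v \<le> W u' v' * W u v" .
    define a x y where "a = W u v" and "x = W u v' - W u v" and "y = W u' v - W u v"
    have "0 < a" "0 \<le> x" "0 \<le> y"
      using Wpos[of u v] mono2[of v v' u] mono1[of u u' v] False that by (auto simp: a_def x_def y_def)
    \<comment> \<open>Log-supermodularity bounds \<open>W u' v'\<close> below by \<open>(a + x) (a + y) /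
      a\<close>, which is \<open>a + x + y + x y / a\<close>.\<close>
    have "(a + x + y) * a \<le> (a + x) * (a + y)"
      using mult_nonneg_nonneg[OF \<open>0 \<le> x\<close> \<open>0 \<le> y\<close>] by (simp add: algebra_simps)
    also have "\<dots> \<le> W u' v' * a" using tp2 by (simp add: a_def x_def y_def)
    finally have "a + x + y \<le> W u' v'" using \<open>0 < a\<close> by simp
    then show ?thesis by (simp add: a_def x_def y_def)
  qed
  have "doubly_substochastic W"
    unfolding doubly_substochastic_def using rect b by auto
  then show ?thesis unfolding W_def[symmetric] by (rule copulaI) (use b in auto)
qed

section \<open>Bivariate distribution functions from copulas\<close>

lemma finite_borel_measure_add:
  assumes M: "finite_borel_measure M" and N: "finite_borel_measure N"
  obtains S where "finite_borel_measure S"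
    "\<And>A. A \<in> sets borel \<Longrightarrow> emeasure S A = emeasure M A + emeasure N A"
proof -
  interpret M: finite_borel_measure M by fact
  interpret N: finite_borel_measure N by fact
  define S where "S = measure_of UNIV (sets borel) (\<lambda>A. emeasure M A + emeasure N A)"
  have s: "sets S = sets borel" using sets.sigma_sets_eq[of "borel :: real measure"] by (simp add: S_def)
  have e: "emeasure S A = emeasure M A + emeasure N A" if "A \<in> sets borel" for A
  proof (rule emeasure_measure_of[OF S_def])
    show "countably_additive (sets S) (\<lambda>A. emeasure M A + emeasure N A)"
      unfolding countably_additive_def
    proof (intro allI impI)
      fix A :: "nat \<Rightarrow> real set" assume "range A \<subseteq> sets S" and d: "disjoint_family A"
      then have r: "range A \<subseteq> sets M" "range A \<subseteq> sets N"
        by (auto simp: s M.M_is_borel N.M_is_borel)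
      show "(\<Sum>i. emeasure M (A i) + emeasure N (A i)) = emeasure M (\<Union>i. A i) + emeasure N (\<Union>i. A i)"
        using suminf_emeasure[OF r(1) d] suminf_emeasure[OF r(2) d] by (simp add: suminf_add[symmetric])
    qed
  qed (use that in \<open>auto simp: S_def positive_def\<close>)
  have "finite_borel_measure S"
    unfolding finite_borel_measure_def finite_borel_measure_axioms_def
    using s e[of UNIV] sets_eq_imp_space_eq[OF s]
    by (auto intro!: finite_measureI simp: M.emeasure_eq_measure N.emeasure_eq_measure)
  then show thesis using e by (rule that)
qed

text \<open>The difference of the distribution functions is itself nondecreasing and right-continuous, so it
  belongs to a measure \<open>K\<close>, and \<open>N = M + K\<close> by uniqueness of distribution functions.\<close>

lemma emeasure_mono_of_cdf_increments:
  assumes M: "finite_borel_measure M" and N: "finite_borel_measure N"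
    and inc: "\<And>x y. x \<le> y \<Longrightarrow> cdf M y - cdf M x \<le> cdf N y - cdf N x"
    and A: "A \<in> sets borel"
  shows "emeasure M A \<le> emeasure N A"
proof -
  interpret M: finite_borel_measure M by fact
  interpret N: finite_borel_measure N by fact
  define d where "d = (\<lambda>x. cdf N x - cdf M x)"
  define m where "m = measure N (space N) - measure M (space M)"
  have d: "\<And>x y. x \<le> y \<Longrightarrow> d x \<le> d y" "\<And>a. continuous (at_right a) d"
     "(d \<longlongrightarrow> 0) at_bot" "(d \<longlongrightarrow> m) at_top"
    using inc tendsto_diff[OF N.cdf_lim_at_bot M.cdf_lim_at_bot]
      tendsto_diff[OF N.cdf_lim_at_top M.cdf_lim_at_top]
    by (auto simp: d_def m_def algebra_simps intro!: continuous_intros M.cdf_is_right_cont N.cdf_is_right_cont)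
  have m: "0 \<le> m"
  proof (rule tendsto_lowerbound[OF d(4)])
    have "0 \<le> d x" for x
      by (rule tendsto_upperbound[OF d(3)]) (auto simp: eventually_at_bot_linorder intro!: exI[of _ x] d(1))
    then show "\<forall>\<^sub>F x in at_top. 0 \<le> d x" by simp
  qed simp
  define K where "K = interval_measure d"
  interpret K: finite_borel_measure K
    unfolding K_def by (rule finite_borel_measure_interval_measure[OF d m])
  obtain S where S: "finite_borel_measure S"
    and e: "\<And>A. A \<in> sets borel \<Longrightarrow> emeasure S A = emeasure M A + emeasure K A"
    using finite_borel_measure_add[OF M K.finite_borel_measure_axioms] by blast
  have "cdf S = cdf N"
  proof
    fix x
    have "measure S {..x} = measure M {..x} + measure K {..x}"
      unfolding measure_def using e[of "{..x}"]
      by (simp add: M.emeasure_eq_measure K.emeasure_eq_measure flip: ennreal_plus)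
    then show "cdf S x = cdf N x"
      using cdf_interval_measure[OF d(1-3)] unfolding K_def[symmetric] by (simp add: cdf_def d_def fun_eq_iff)
  qed
  then have "S = N" using S N by (intro cdf_unique') auto
  then show ?thesis using e[OF A] by simp
qed

lemma density_le_imp_AE_le:
  assumes [measurable]: "f \<in> borel_measurable M" "g \<in> borel_measurable M"
    and fin: "integral\<^sup>N M g \<noteq> \<infinity>"
    and le: "\<And>A. A \<in> sets M \<Longrightarrow> emeasure (density M f) A \<le> emeasure (density M g) A"
  shows "AE x in M. f x \<le> g x"
proof -
  define A where "A = {x \<in> space M. g x < f x}"
  have A[measurable]: "A \<in> sets M" by (simp add: A_def)
  have gA: "(\<integral>\<^sup>+x. g x * indicator A x \<partial>M) \<noteq> \<infinity>"
  proof -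
    have "(\<integral>\<^sup>+x. g x * indicator A x \<partial>M) \<le> integral\<^sup>N M g"
      by (intro nn_integral_mono) (auto split: split_indicator)
    then show ?thesis using fin by (auto simp: top_unique)
  qed
  have "(\<integral>\<^sup>+x. f x * indicator A x - g x * indicator A x \<partial>M)
      = (\<integral>\<^sup>+x. f x * indicator A x \<partial>M) - (\<integral>\<^sup>+x. g x * indicator A x \<partial>M)"
    by (rule nn_integral_diff) (use gA in \<open>auto simp: A_def split: split_indicator\<close>)
  also have "\<dots> = 0"
    using le[OF A] gA
    by (intro diff_eq_0_ennreal) (auto simp: emeasure_density less_top[symmetric] top_unique)
  finally have "AE x in M. f x * indicator A x - g x * indicator A x = 0"
    by (subst (asm) nn_integral_0_iff_AE) auto
  moreover have "AE x in M. g x \<noteq> \<infinity>" by (rule nn_integral_PInf_AE[OF _ fin]) simp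
  moreover note AE_space
  ultimately show ?thesis
  proof eventually_elim
    case (elim x)
    then show ?case 
      by (cases "x \<in> A") (auto simp: A_def ennreal_minus_eq_0 indicator_def)
  qed
qed


lemma tendsto_copula:
  assumes C: "copula C" and f: "(f \<longlongrightarrow> l) F" "\<And>x. f x \<in> {0..1}" "l \<in> {0..1}" and t: "t \<in> {0..1}"
  shows "((\<lambda>x. C (f x) t) \<longlongrightarrow> C l t) F" "((\<lambda>x. C t (f x)) \<longlongrightarrow> C t l) F"
proof -
  note Q = copula_imp_doubly_substochastic[OF C]
  have "dist (C u t) (C v t) \<le> dist u v \<and> dist (C t u) (C t v) \<le> dist u v"
    if "u \<in> {0..1}" "v \<in> {0..1}" for u v
    using doubly_substochastic_increment1[OF Q, of u v t] doubly_substochastic_increment1[OF Q, of v u t]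
      doubly_substochastic_increment2[OF Q, of u v t] doubly_substochastic_increment2[OF Q, of v u t] that t
    by (auto simp: dist_real_def abs_if)
  then show "((\<lambda>x. C (f x) t) \<longlongrightarrow> C l t) F" "((\<lambda>x. C t (f x)) \<longlongrightarrow> C t l) F"
    using f by (auto intro!: metric_tendsto_imp_tendsto[OF f(1)] always_eventually)
qed

text \<open>For a pair \<open>(X, V)\<close> with \<open>X\<close> distributed as \<open>M\<close>, \<open>V\<close> uniform, and copula \<open>C\<close>, the function \<open>f q\<close> is the
  conditional probability of \<open>V \<le> q\<close> given \<open>X\<close>. It is constructed as the density with respect to \<open>M\<close> of the
  measure with distribution function \<open>x \<mapsto> C (cdf M x) q\<close>; since \<open>C\<close> is 2-increasing, these measures
  increase with \<open>q\<close>, and they reach \<open>M\<close> at \<open>q = 1\<close>.\<close>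

lemma copula_conditional_df:
  fixes M :: "real measure"
  assumes C: "copula C" and M: "real_distribution M"
  obtains f :: "real \<Rightarrow> real \<Rightarrow> ennreal" where
    "\<And>q. f q \<in> borel_measurable borel" "f 1 = (\<lambda>_. 1)"
    "\<And>q x. q \<in> {0..1} \<Longrightarrow> (\<integral>\<^sup>+y. f q y * indicator {..x} y \<partial>M) = C (cdf M x) q"
    "\<And>q. q \<in> {0..1} \<Longrightarrow> integral\<^sup>N M (f q) = q"
    "\<And>q q'. q \<in> {0..1} \<Longrightarrow> q' \<in> {0..1} \<Longrightarrow> q \<le> q' \<Longrightarrow> AE x in M. f q x \<le> f q' x"
proof -
  interpret M: real_distribution M by fact
  note Q = copula_imp_doubly_substochastic[OF C]
  have C1: "C 1 q = q" "C q 1 = q" "C 0 q = 0" if "q \<in> {0..1}" for q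
    using C that unfolding copula_def by auto
  have r: "cdf M x \<in> {0..1}" for x using M.cdf_nonneg M.cdf_bounded_prob by auto
  define G where "G = (\<lambda>q x. C (cdf M x) q)"
  define N where "N = (\<lambda>q. interval_measure (G q))"
  have G: "\<And>x y. x \<le> y \<Longrightarrow> G q x \<le> G q y" "\<And>a. continuous (at_right a) (G q)"
    "(G q \<longlongrightarrow> 0) at_bot" "(G q \<longlongrightarrow> q) at_top" if q: "q \<in> {0..1}" for q
  proof -
    show "G q x \<le> G q y" if "x \<le> y" for x y
      using doubly_substochastic_increment1(1)[OF Q, of "cdf M x" "cdf M y" q] r[of x] r[of y]
        M.cdf_nondecreasing[OF that] q by (auto simp: G_def)
    show "continuous (at_right a) (G q)" for a
      unfolding continuous_within G_def
      by (rule tendsto_copula(1)[OF C _ r r q]) (use M.cdf_is_right_cont in \<open>simp add: continuous_within\<close>)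
    show "(G q \<longlongrightarrow> 0) at_bot" "(G q \<longlongrightarrow> q) at_top"
      using tendsto_copula(1)[OF C M.cdf_lim_at_bot r _ q] tendsto_copula(1)[OF C M.cdf_lim_at_top_prob r _ q]
        C1[OF q] by (simp_all add: G_def)
  qed
  have N: "finite_borel_measure (N q)" "cdf (N q) = G q" "emeasure (N q) UNIV = q"
    "\<And>x. emeasure (N q) {..x} = G q x" if q: "q \<in> {0..1}" for q
    unfolding N_def
    using finite_borel_measure_interval_measure[OF G[OF q]] interval_measure_UNIV[OF G[OF q]]
      cdf_interval_measure[OF G(1-3)[OF q]] emeasure_interval_measure_Iic[OF G(1-3)[OF q]] q by auto
  have N_mono: "emeasure (N q) A \<le> emeasure (N q') A"
    if q: "q \<in> {0..1}" "q' \<in> {0..1}" "q \<le> q'" and A: "A \<in> sets borel" for q q' A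
  proof (rule emeasure_mono_of_cdf_increments[OF N(1) N(1) _ A])
    show "cdf (N q) y - cdf (N q) x \<le> cdf (N q') y - cdf (N q') x" if "x \<le> y" for x y
      using doubly_substochastic_rectangle[OF Q, of "cdf M x" "cdf M y" q q'] r[of x] r[of y]
        M.cdf_nondecreasing[OF that] q by (simp add: N G_def)
  qed (use q in auto)
  have "cdf (N 1) = cdf M" using N(2)[of 1] r C1(2) by (auto simp: G_def fun_eq_iff)
  then have N1: "N 1 = M" using N(1)[of 1] M.finite_borel_measure_M by (intro cdf_unique') auto
  have "\<exists>f\<in>borel_measurable M. density M f = N q" if q: "q \<in> {0..1}" for q
  proof (rule M.Radon_Nikodym)
    show "absolutely_continuous M (N q)"
      unfolding absolutely_continuous_def
    proof
      fix A assume "A \<in> null_sets M"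
      then show "A \<in> null_sets (N q)"
        using N_mono[OF q, of 1 A] q unfolding N1 by (auto simp: null_sets_def N_def)
    qed
  qed (simp add: N_def)
  then obtain g where g: "\<And>q. q \<in> {0..1} \<Longrightarrow> g q \<in> borel_measurable M"
    "\<And>q. q \<in> {0..1} \<Longrightarrow> density M (g q) = N q" by metis
  \<comment> \<open>Densities are determined only almost everywhere; the constant version at level 1 makes
    the upper end of the conditional distribution exact.\<close>
  define f where "f = (\<lambda>q. if q \<in> {0..<1} then g q else (\<lambda>_. 1))"
  have f: "f q \<in> borel_measurable M" for q using g(1) by (simp add: f_def)
  have fN: "density M (f q) = N q" if "q \<in> {0..1}" for q
    using that g(2)[of q] by (cases "q = 1") (auto simp: f_def N1 density_1)
  have m: "f q \<in> borel_measurable borel" for q using f[of q] by simp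
  have i: "integral\<^sup>N M (f q) = q" if q: "q \<in> {0..1}" for q
    using emeasure_density[OF f, of UNIV q] N(3)[OF q] by (simp add: fN[OF q])
  show thesis
  proof (rule that[OF m _ _ i])
    show "f 1 = (\<lambda>_. 1)" by (simp add: f_def)
    show "(\<integral>\<^sup>+y. f q y * indicator {..x} y \<partial>M) = C (cdf M x) q" if q: "q \<in> {0..1}" for q x
      using emeasure_density[OF f, of "{..x}" q] N(4)[OF q, of x] by (simp add: fN[OF q] G_def)
    show "AE x in M. f q x \<le> f q' x" if "q \<in> {0..1}" "q' \<in> {0..1}" "q \<le> q'" for q q'
      using N_mono[OF that] that
      by (intro density_le_imp_AE_le f) (simp_all add: i fN)
  qed
qed

text \<open>The pair is built by conditional sampling. Draw \<open>r\<close> from \<open>M1\<close> and an independent uniform \<open>w\<close>, let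
  \<open>Y (r, w)\<close> be the \<open>w\<close>-quantile of the conditional distribution \<open>q \<mapsto> f q r\<close> of the second coordinate,
  and transport \<open>Y\<close>, which is uniform, to \<open>M2\<close> by the quantile function of \<open>M2\<close>. The quantile is an
  infimum over rational levels, so that the almost sure monotonicity of \<open>f\<close> involves countably many null
  sets only; other levels are reached by continuity of \<open>C\<close>.\<close>

theorem bivariate_df_copula:
  fixes M1 M2 :: "real measure"
  assumes C: "copula C" and M1: "real_distribution M1" and M2: "real_distribution M2"
  shows "bivariate_df (\<lambda>x y. C (cdf M1 x) (cdf M2 y))"
    and "marginal1 (\<lambda>x y. C (cdf M1 x) (cdf M2 y)) = cdf M1"
    and "marginal2 (\<lambda>x y. C (cdf M1 x) (cdf M2 y)) = cdf M2"
proof -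
  interpret M1: real_distribution M1 by fact
  interpret M2: cdf_distribution M2 unfolding cdf_distribution_def by fact
  note Q = copula_imp_doubly_substochastic[OF C]
  have C1: "C 1 q = q" "C q 1 = q" "C 0 q = 0" "C q 0 = 0" if "q \<in> {0..1}" for q
    using C that unfolding copula_def by auto
  have r: "cdf M1 x \<in> {0..1}" "cdf M2 x \<in> {0..1}" for x
    using M1.cdf_nonneg M1.cdf_bounded_prob M2.cdf_nonneg M2.cdf_bounded_prob by auto
  show "marginal1 (\<lambda>x y. C (cdf M1 x) (cdf M2 y)) = cdf M1"
    unfolding marginal1_def using tendsto_copula(2)[OF C M2.cdf_lim_at_top_prob r(2) _ r(1)] r
    by (auto intro!: ext tendsto_Lim simp: C1)
  show "marginal2 (\<lambda>x y. C (cdf M1 x) (cdf M2 y)) = cdf M2"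
    unfolding marginal2_def using tendsto_copula(1)[OF C M1.cdf_lim_at_top_prob r(1) _ r(2)] r
    by (auto intro!: ext tendsto_Lim simp: C1)
  define R :: "real set" where "R = \<rat> \<inter> {0..1}"
  have R: "countable R" "R \<noteq> {}" by (auto simp: R_def countable_rat)
  obtain f where f[measurable]: "\<And>q. f q \<in> borel_measurable borel" and f1: "f 1 = (\<lambda>_. 1)"
    and f_Iic: "\<And>q x. q \<in> {0..1} \<Longrightarrow> (\<integral>\<^sup>+y. f q y * indicator {..x} y \<partial>M1) = C (cdf M1 x) q"
    and f_UNIV: "\<And>q. q \<in> {0..1} \<Longrightarrow> integral\<^sup>N M1 (f q) = q"
    and f_mono: "\<And>q q'. q \<in> {0..1} \<Longrightarrow> q' \<in> {0..1} \<Longrightarrow> q \<le> q' \<Longrightarrow> AE x in M1. f q x \<le> f q' x"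
    using copula_conditional_df[OF C M1] by blast
  define U where "U = uniform_measure lborel {0..1::real}"
  have sU[measurable_cong]: "sets U = sets borel" by (simp add: U_def)
  interpret U: prob_space U
    unfolding U_def by (rule prob_space_uniform_measure) auto
  define P where "P = M1 \<Otimes>\<^sub>M U"
  have sP[measurable_cong]: "sets P = sets (borel \<Otimes>\<^sub>M borel)" unfolding P_def by (intro sets_pair_measure_cong) (auto simp: sU)
  have spP: "space P = UNIV" using sets_eq_imp_space_eq[OF sP] by (simp add: space_pair_measure)
  interpret PP: pair_prob_space M1 U ..
  interpret P: prob_space P unfolding P_def by (rule PP.prob_space_axioms)
  have U_le: "emeasure U {w. ennreal w \<le> c} = c" if "c \<le> 1" for c
  proof -
    have "{0..1} \<inter> {w. ennreal w \<le> c} = {0..enn2real c}"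
      using that by (cases c) (auto simp: ennreal_le_iff2 top_unique)
    moreover have "{w. ennreal w \<le> c} \<in> sets lborel" by measurable
    ultimately show ?thesis using that by (cases c) (auto simp: U_def top_unique divide_ennreal_def)
  qed
  \<comment> \<open>The default value 1 keeps the infimum in \<open>[0, 1]\<close> for every \<open>(r,
    w)\<close>.\<close>
  define Y where "Y = (\<lambda>(r, w). INF q\<in>R. if ennreal w \<le> f q r then q else 1)"
  have Y[measurable]: "Y \<in> borel_measurable P"
    unfolding Y_def case_prod_beta by (rule borel_measurable_cINF_real[OF R(1)]) measurable
  have bdd: "bdd_below ((\<lambda>q. if ennreal w \<le> f q r then q else 1) ` R)" for w r
    by (auto simp: R_def intro!: bdd_belowI[of _ 0])
  define E where "E = (\<lambda>A q. {z. fst z \<in> A \<and> ennreal (snd z) \<le> f q (fst z)})"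
  have E[measurable]: "E A q \<in> sets P" if [measurable]: "A \<in> sets borel" for A q
  proof -
    have "E A q = {z \<in> space P. fst z \<in> A \<and> ennreal (snd z) \<le> f q (fst z)}" by (auto simp: E_def spP)
    then show ?thesis by simp
  qed
  have E_meas: "emeasure P (E A q) = (\<integral>\<^sup>+y. f q y * indicator A y \<partial>M1)"
    if A: "A \<in> sets borel" and q: "q \<in> {0..1}" for A q
  proof -
    have "emeasure P (E A q) = (\<integral>\<^sup>+r. emeasure U (Pair r -` E A q) \<partial>M1)"
      using E[OF A, of q] unfolding P_def by (rule U.emeasure_pair_measure_alt)
    also have "\<dots> = (\<integral>\<^sup>+y. f q y * indicator A y \<partial>M1)"
    proof (rule nn_integral_cong_AE)
      show "AE r in M1. emeasure U (Pair r -` E A q) = f q r * indicator A r"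
        using f_mono[of q 1] q
        by (auto simp: E_def vimage_def f1 indicator_def U_le elim!: eventually_mono)
    qed
    finally show ?thesis .
  qed
  have E_sub: "E A q \<subseteq> {z. fst z \<in> A \<and> Y z \<le> q}" if "q \<in> R" for A q
    using cINF_lower2[OF bdd that] by (auto simp: E_def Y_def)
  have AE_mono: "AE z in P. \<forall>q\<in>R. \<forall>q'\<in>R. q \<le> q' \<longrightarrow> f q (fst z) \<le> f q' (fst z)"
  proof -
    have "AE z in M1 \<Otimes>\<^sub>M U. f q (fst z) \<le> f q' (fst z)" if "q \<in> R" "q' \<in> R" "q \<le> q'" for q q'
    proof (rule PP.AE_pair_measure)
      show "{z \<in> space (M1 \<Otimes>\<^sub>M U). f q (fst z) \<le> f q' (fst z)} \<in> sets (M1 \<Otimes>\<^sub>M U)" by measurable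
      show "AE x in M1. AE y in U. f q (fst (x, y)) \<le> f q' (fst (x, y))"
        using f_mono[of q q'] that by (auto simp: R_def elim!: eventually_mono)
    qed
    then show ?thesis unfolding P_def using R(1) by (auto simp: AE_ball_countable)
  qed
  have sub_E: "AE z in P. fst z \<in> A \<longrightarrow> Y z < q' \<longrightarrow> z \<in> E A q'" if "q' \<in> R" for A q'
    using AE_mono
  proof eventually_elim
    case (elim z)
    show ?case
    proof (intro impI)
      assume A: "fst z \<in> A" and "Y z < q'"
      then obtain q where "q \<in> R" "(if ennreal (snd z) \<le> f q (fst z) then q else 1) < q'"
        using cINF_less_iff[OF R(2) bdd, of "snd z" "fst z" q'] by (auto simp: Y_def case_prod_beta)
      moreover have "q' \<le> 1" using that by (simp add: R_def)
      ultimately have "ennreal (snd z) \<le> f q (fst z)" "q < q'" by (auto split: if_splits)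
      moreover have "f q (fst z) \<le> f q' (fst z)" using elim \<open>q \<in> R\<close> that \<open>q < q'\<close> by auto
      ultimately show "z \<in> E A q'" using A by (auto simp: E_def)
    qed
  qed
  \<comment> \<open>The set \<open>A\<close> is to be a half-line, for the joint law, or
    \<open>UNIV\<close>, for the law of \<open>Y\<close> alone.\<close>
  have Y_le: "measure P {z. fst z \<in> A \<and> Y z \<le> v} = C s v"
    if A[measurable]: "A \<in> sets borel" and s: "s \<in> {0..1}" and v: "v \<in> {0..1}"
      and c: "\<And>q. q \<in> {0..1} \<Longrightarrow> (\<integral>\<^sup>+y. f q y * indicator A y \<partial>M1) = C s q" for A s v
  proof -
    have Em: "measure P (E A q) = C s q" if "q \<in> {0..1}" for q
      using E_meas[OF A that] c[OF that] doubly_substochastic_bounds(1)[OF Q, of s q] s that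
      by (simp add: measure_def)
    have [measurable]: "{z. fst z \<in> A \<and> Y z \<le> v} \<in> sets P"
    proof -
      have "{z. fst z \<in> A \<and> Y z \<le> v} = {z \<in> space P. fst z \<in> A \<and> Y z \<le> v}" by (simp add: spP)
      then show ?thesis by simp
    qed
    have lo: "C s q \<le> measure P {z. fst z \<in> A \<and> Y z \<le> v}" if "q \<in> R" "q \<le> v" for q
    proof -
      have "measure P (E A q) \<le> measure P {z. fst z \<in> A \<and> Y z \<le> v}"
        using E_sub[OF that(1), of A] that(2) by (intro P.finite_measure_mono) auto
      then show ?thesis using Em[of q] that by (simp add: R_def)
    qed
    have hi: "measure P {z. fst z \<in> A \<and> Y z \<le> v} \<le> C s q" if "q \<in> R" "v < q" for q
    proof -
      have "measure P {z. fst z \<in> A \<and> Y z \<le> v} \<le> measure P (E A q)"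
        using sub_E[OF that(1), of A] that(2) by (intro P.finite_measure_mono_AE) auto
      then show ?thesis using Em[of q] that by (simp add: R_def)
    qed
    note inc = doubly_substochastic_increment2[OF Q]
    show ?thesis
    proof (rule antisym)
      show "C s v \<le> measure P {z. fst z \<in> A \<and> Y z \<le> v}"
      proof (rule field_le_epsilon)
        fix e :: real assume "0 < e"
        show "C s v \<le> measure P {z. fst z \<in> A \<and> Y z \<le> v} + e"
        proof (cases "v = 0")
          case True then show ?thesis using \<open>0 < e\<close> C1(4)[OF s] by (simp add: add_nonneg_nonneg)
        next
          case False
          then obtain q where "q \<in> \<rat>" "max 0 (v - e) < q" "q < v"
            using Rats_dense_in_real[of "max 0 (v - e)" v] \<open>0 < e\<close> v by auto
          then show ?thesis using lo[of q] inc(2)[of q v s] v s by (auto simp: R_def)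
        qed
      qed
      show "measure P {z. fst z \<in> A \<and> Y z \<le> v} \<le> C s v"
      proof (cases "v = 1")
        case True
        have "AE w in U. ennreal w \<le> 1"
          unfolding U_def by (rule AE_uniform_measureI) auto
        then have "AE z in P. ennreal (snd z) \<le> 1"
          unfolding P_def
        proof (intro PP.AE_pair_measure)
          show "{z \<in> space (M1 \<Otimes>\<^sub>M U). ennreal (snd z) \<le> 1} \<in> sets (M1 \<Otimes>\<^sub>M U)" by measurable
        qed auto
        then have "AE z in P. z \<in> {z. fst z \<in> A \<and> Y z \<le> v} \<longrightarrow> z \<in> E A 1"
          by eventually_elim (auto simp: E_def f1)
        then have "measure P {z. fst z \<in> A \<and> Y z \<le> v} \<le> measure P (E A 1)"
          by (rule P.finite_measure_mono_AE) (rule E[OF A])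
        then show ?thesis using Em[of 1] True by simp
      next
        case False
        show ?thesis
        proof (rule field_le_epsilon)
          fix e :: real assume "0 < e"
          then obtain q where "q \<in> \<rat>" "v < q" "q < min 1 (v + e)"
            using Rats_dense_in_real[of v "min 1 (v + e)"] False v by auto
          then show "measure P {z. fst z \<in> A \<and> Y z \<le> v} \<le> C s v + e"
            using hi[of q] inc(2)[of v q s] v s by (auto simp: R_def)
        qed
      qed
    qed
  qed
  have Y_marg: "measure P {z. Y z \<le> v} = v" if "v \<in> {0..1}" for v
    using Y_le[of UNIV 1 v] that f_UNIV C1(1) by simp
  have Y_Iic: "measure P {z. fst z \<le> x \<and> Y z \<le> v} = C (cdf M1 x) v" if "v \<in> {0..1}" for x v
    using Y_le[of "{..x}" "cdf M1 x" v] that f_Iic r by simp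
  have Y_sets: "{z. Y z \<le> v} \<in> sets P" "{z. Y z < v} \<in> sets P" for v
    using measurable_sets[OF Y, of "{..v}"] measurable_sets[OF Y, of "{..<v}"]
    by (auto simp: vimage_def spP)
  have AE_Y: "AE z in P. 0 < Y z \<and> Y z < 1"
  proof -
    have "AE z in P. z \<notin> {z. Y z \<le> 0}"
      using Y_sets(1)[of 0] Y_marg[of 0] by (intro AE_not_in) (simp add: null_sets_def P.emeasure_eq_measure)
    moreover have "1 \<le> measure P {z. Y z < 1}"
    proof (rule field_le_epsilon)
      fix e :: real assume "0 < e"
      define v where "v = max 0 (1 - e)"
      have "v = measure P {z. Y z \<le> v}" using Y_marg[of v] \<open>0 < e\<close> by (simp add: v_def)
      also have "\<dots> \<le> measure P {z. Y z < 1}"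
        using \<open>0 < e\<close> Y_sets by (intro P.finite_measure_mono) (auto simp: v_def)
      finally show "1 \<le> measure P {z. Y z < 1} + e" by (simp add: v_def)
    qed
    then have "AE z in P. z \<in> {z. Y z < 1}"
      using Y_sets(2)[of 1] P.prob_le_1[of "{z. Y z < 1}"] by (subst P.prob_eq_1[symmetric]) auto
    ultimately show ?thesis by eventually_elim auto
  qed
  \<comment> \<open>The quantile function is meaningful on \<open>(0, 1)\<close> only, and \<open>Y\<close>
    lies there almost surely.\<close>
  define J where "J = (\<lambda>v. if v \<in> {0<..<1} then M2.I v else 0)"
  have [measurable]: "J \<in> borel_measurable borel"
    unfolding J_def
    by (rule measurable_restrict_space_iff[THEN iffD1, OF _ _ M2.measurable_CI]) auto
  define M where "M = distr P borel (\<lambda>z. (fst z, J (Y z)))"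
  have m: "(\<lambda>z. (fst z, J (Y z))) \<in> measurable P borel"
    unfolding borel_prod[symmetric] by measurable
  have "bdf_of M x y = C (cdf M1 x) (cdf M2 y)" for x y
  proof -
    have "bdf_of M x y = measure P {z. fst z \<le> x \<and> J (Y z) \<le> y}"
      unfolding bdf_of_def M_def
      by (subst measure_distr[OF m]) (auto simp: spP vimage_def borel_closed closed_Times)
    also have "\<dots> = measure P {z. fst z \<le> x \<and> Y z \<le> cdf M2 y}"
    proof (rule measure_eq_AE)
      show "AE z in P. (z \<in> {z. fst z \<le> x \<and> J (Y z) \<le> y}) = (z \<in> {z. fst z \<le> x \<and> Y z \<le> cdf M2 y})"
        using AE_Y by eventually_elim (auto simp: J_def M2.pseudoinverse[symmetric])
      have "{z \<in> space P. fst z \<le> x \<and> J (Y z) \<le> y} \<in> sets P"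
        "{z \<in> space P. fst z \<le> x \<and> Y z \<le> cdf M2 y} \<in> sets P" by measurable
      then show "{z. fst z \<le> x \<and> J (Y z) \<le> y} \<in> sets P"
        "{z. fst z \<le> x \<and> Y z \<le> cdf M2 y} \<in> sets P" by (simp_all add: spP)
    qed
    also have "\<dots> = C (cdf M1 x) (cdf M2 y)" using Y_Iic r by simp
    finally show ?thesis .
  qed
  then have "(\<lambda>x y. C (cdf M1 x) (cdf M2 y)) = bdf_of M" by (auto simp: fun_eq_iff)
  moreover have "prob_space M" unfolding M_def using m by (rule P.prob_space_distr)
  ultimately show "bivariate_df (\<lambda>x y. C (cdf M1 x) (cdf M2 y))"
    unfolding bivariate_df_def by (auto simp: M_def)
qed

section \<open>Survival copulas and limits\<close>

text \<open>If \<open>X\<close> has law \<open>M\<close>, its survival probability \<open>1 - cdf M X\<close> can be turned into a uniform variable by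
  randomizing within the atoms, and \<open>g s x\<close> is the conditional probability that the result is at most \<open>s\<close>
  given \<open>X = x\<close>. Explicitly, \<open>g s\<close> is 1 above the point \<open>q s\<close> at which the survival function
  crosses the level \<open>s\<close>, and it takes the fraction of the atom at \<open>q s\<close> that is needed for the integral to be
  exactly \<open>s\<close>. When \<open>s\<close> is a value of the survival function, no atom is split.\<close>

lemma uniform_randomization:
  fixes M :: "real measure"
  assumes M: "real_distribution M"
  obtains g :: "real \<Rightarrow> real \<Rightarrow> real" where
    "\<forall>s. g s \<in> borel_measurable borel" "\<forall>s x. g s x \<in> {0..1}"
    "g 0 = (\<lambda>_. 0)" "g 1 = (\<lambda>_. 1)"
    "\<forall>s\<in>{0..1}. \<forall>s'\<in>{0..1}. \<forall>x. s \<le> s' \<longrightarrow> g s x \<le> g s' x"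
    "\<forall>s\<in>{0..1}. (LINT x|M. g s x) = s"
    "\<forall>x. AE y in M. g (1 - cdf M x) y = 1 - indicator {..x} y"
proof -
  interpret M: cdf_distribution M unfolding cdf_distribution_def by fact
  have univ: "measure M UNIV = 1" using M.prob_space M.space_eq_univ by metis
  define q where "q = (\<lambda>s. M.I (1 - s))"
  define p where "p = (\<lambda>s. measure M {q s})"
  define c where "c = (\<lambda>s. (s - (1 - cdf M (q s))) / p s)"
  define g where "g = (\<lambda>s x. if s \<le> 0 then 0 else if s \<ge> 1 then 1
     else indicator {q s<..} x + c s * indicator {q s} x)"
  have q_le: "1 - s \<le> cdf M x \<longleftrightarrow> q s \<le> x" if "0 < s" "s < 1" for s x
    unfolding q_def using that by (intro M.pseudoinverse) auto
  have T_le: "1 - cdf M (q s) \<le> s" if "0 < s" "s < 1" for s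
    using q_le[OF that, of "q s"] by simp
  \<comment> \<open>At \<open>q s\<close> the survival function jumps across the level \<open>s\<close> or
    passes through it, so \<open>c s\<close> is a proportion. Without an atom \<open>c s = 0\<close> by
    division by zero, which is harmless as \<open>p s = 0\<close>.\<close>
  have T_ge: "s \<le> 1 - cdf M (q s) + p s" if s: "0 < s" "s < 1" for s
  proof -
    have "measure M {..<q s} \<le> 1 - s"
    proof (rule tendsto_upperbound[OF M.cdf_at_left])
      have "cdf M x \<le> 1 - s" if "x < q s" for x using q_le[OF s, of x] that by auto
      then show "\<forall>\<^sub>F x in at_left (q s). cdf M x \<le> 1 - s"
        by (auto simp: eventually_at_filter)
    qed simp
    moreover have "cdf M (q s) = measure M {..<q s} + p s"
      unfolding cdf_def p_def ivl_disj_un(2)[symmetric] by (subst M.finite_measure_Union) auto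
    ultimately show ?thesis by simp
  qed
  have c: "0 \<le> c s" "c s \<le> 1" if "0 < s" "s < 1" for s
    using T_le[OF that] T_ge[OF that] measure_nonneg[of M "{q s}"]
    by (auto simp: c_def p_def divide_le_eq_1 less_le)
  have cp: "c s * p s = s - (1 - cdf M (q s))" if "0 < s" "s < 1" for s
    using T_le[OF that] T_ge[OF that] by (auto simp: c_def)
  have q_mono: "q s' \<le> q s" if "0 < s" "s \<le> s'" "s' < 1" for s s'
    using q_le[of s' "q s"] q_le[of s "q s"] that by auto
  have meas: "g s \<in> borel_measurable borel" for s unfolding g_def by measurable
  have bounds: "g s x \<in> {0..1}" for s x
    using c[of s] by (auto simp: g_def indicator_def)
  have int: "integrable M (g s)" for s
    using bounds meas by (intro M.integrable_const_bound[where B=1]) auto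
  have ind: "integrable M (\<lambda>y. 1 - indicator {..x} y :: real)" for x
    by (intro M.integrable_const_bound[where B=1]) (auto simp: indicator_def)
  have mono: "g s x \<le> g s' x" if s: "s \<in> {0..1}" "s' \<in> {0..1}" "s \<le> s'" for s s' x
  proof (cases "s = 0 \<or> s' = 1")
    case True
    then show ?thesis using bounds[of s x] bounds[of s' x] by (auto simp: g_def)
  next
    case False
    then have s': "0 < s" "s < 1" "0 < s'" "s' < 1" using s by auto
    show ?thesis
    proof (cases "q s' = q s")
      case True
      then have "c s \<le> c s'" using s by (auto simp: c_def p_def intro!: divide_right_mono)
      then show ?thesis using s' True by (simp add: g_def mult_right_mono)
    next
      case False
      then have "q s' < q s" using q_mono[OF s'(1) s(3) s'(4)] by auto
      then show ?thesis using s' c[of s] c[of s'] by (auto simp: g_def indicator_def)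
    qed
  qed
  have g_int: "(LINT x|M. g s x) = s" if s: "s \<in> {0..1}" for s
  proof (cases "s = 0 \<or> s = 1")
    case True
    then show ?thesis using univ by (auto simp: g_def)
  next
    case False
    then have s': "0 < s" "s < 1" using s by auto
    have "measure M {q s<..} = 1 - cdf M (q s)"
      using M.prob_compl[of "{..q s}"] by (simp add: cdf_def Compl_eq_Diff_UNIV[symmetric] Compl_atMost)
    moreover have "(LINT x|M. indicator {q s<..} x + c s * indicator {q s} x)
        = measure M {q s<..} + c s * p s"
      by (subst Bochner_Integration.integral_add) (auto simp: p_def less_top[symmetric])
    ultimately show ?thesis using s' cp by (simp add: g_def)
  qed
  have i_int: "(LINT y|M. 1 - indicator {..x} y) = 1 - cdf M x" for x
    by (subst Bochner_Integration.integral_diff) (auto simp: cdf_def less_top[symmetric] univ)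
  have "AE y in M. g (1 - cdf M x) y = 1 - indicator {..x} y" for x
  proof -
    define s where "s = 1 - cdf M x"
    have s: "s \<in> {0..1}" using M.cdf_nonneg[of x] M.cdf_bounded_prob[of x] by (auto simp: s_def)
    \<comment> \<open>The two functions have equal integrals and one of them dominates the other, so they
      agree almost everywhere.\<close>
    have eq0: "(LINT y|M. g s y - (1 - indicator {..x} y)) = 0"
      using g_int[OF s] i_int int ind by (simp add: s_def)
    consider "s = 0" | "0 < s" using s by fastforce
    then have "AE y in M. g s y - (1 - indicator {..x} y) = 0"
    proof cases
      case 1
      have "AE y in M. (1 - indicator {..x} y) - g s y = 0"
        using eq0 int ind 1 unfolding Bochner_Integration.integral_diff[OF int ind]
        by (subst integral_nonneg_eq_0_iff_AE[symmetric])
          (auto simp: g_def Bochner_Integration.integral_diff indicator_def)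
      then show ?thesis by eventually_elim simp
    next
      case 2
      have "1 - indicator {..x} y \<le> g s y" for y
      proof (cases "s = 1")
        case False
        then have "q s \<le> x" using q_le[of s x] 2 s by (simp add: s_def)
        then show ?thesis using bounds[of s y] 2 False s by (auto simp: g_def indicator_def)
      qed (auto simp: g_def)
      then show ?thesis
        using eq0 int ind by (subst integral_nonneg_eq_0_iff_AE[symmetric]) auto
    qed
    then show ?thesis unfolding s_def by eventually_elim simp
  qed
  moreover have "g 0 = (\<lambda>_. 0)" "g 1 = (\<lambda>_. 1)" by (auto simp: g_def)
  ultimately show thesis using that[of g] meas bounds mono g_int by blast
qed

text \<open>This is Sklar's theorem for survival functions. With the randomizations \<open>g\<close>, \<open>h\<close> of
  the two coordinates, \<open>C s t\<close> is the expectation of \<open>g s X * h t Y\<close>. Monotonicity of \<open>g\<close> and \<open>h\<close> in the level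
  makes \<open>C\<close> 2-increasing, and at values of the marginal survival functions the product is
  almost surely the indicator of the open upper right quadrant.\<close>

lemma survival_copula:
  assumes G: "bivariate_df G"
  obtains C where "copula C"
    "\<And>x y. G x y = marginal1 G x + marginal2 G y - 1 + C (1 - marginal1 G x) (1 - marginal2 G y)"
proof -
  obtain M where M: "prob_space M" and S: "sets M = sets (borel :: (real \<times> real) measure)"
    and GM: "G = bdf_of M"
    using G unfolding bivariate_df_def by blast
  interpret prob_space M by fact
  have sp: "space M = UNIV" using sets_eq_imp_space_eq[OF S] by simp
  have m[measurable]: "fst \<in> borel_measurable M" "snd \<in> borel_measurable M"
    using measurable_cong_sets[OF S refl] by (auto simp: borel_prod[symmetric])
  define M1 M2 where "M1 = distr M borel fst" and "M2 = distr M borel snd"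
  have d: "real_distribution M1" "real_distribution M2" unfolding M1_def M2_def by auto
  have marg: "marginal1 G = cdf M1" "marginal2 G = cdf M2"
    using marginal_bdf_of[OF M S] by (simp_all add: GM M1_def M2_def)
  obtain g :: "real \<Rightarrow> real \<Rightarrow> real" where g: "\<forall>s. g s \<in> borel_measurable borel" "\<forall>s x. g s x \<in> {0..1}"
    and g01: "g 0 = (\<lambda>_. 0)" "g 1 = (\<lambda>_. 1)"
    and gm: "\<forall>s\<in>{0..1}. \<forall>s'\<in>{0..1}. \<forall>x. s \<le> s' \<longrightarrow> g s x \<le> g s' x"
    and gi: "\<forall>s\<in>{0..1}. (LINT x|M1. g s x) = s"
    and gx: "\<forall>x. AE y in M1. g (1 - cdf M1 x) y = 1 - indicator {..x} y"
    using uniform_randomization[OF d(1)] by blast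
  obtain h :: "real \<Rightarrow> real \<Rightarrow> real" where h: "\<forall>s. h s \<in> borel_measurable borel" "\<forall>s x. h s x \<in> {0..1}"
    and h01: "h 0 = (\<lambda>_. 0)" "h 1 = (\<lambda>_. 1)"
    and hm: "\<forall>s\<in>{0..1}. \<forall>s'\<in>{0..1}. \<forall>x. s \<le> s' \<longrightarrow> h s x \<le> h s' x"
    and hi: "\<forall>s\<in>{0..1}. (LINT x|M2. h s x) = s"
    and hx: "\<forall>x. AE y in M2. h (1 - cdf M2 x) y = 1 - indicator {..x} y"
    using uniform_randomization[OF d(2)] by blast
  have gb: "0 \<le> g s x" "g s x \<le> 1" and hb: "0 \<le> h s x" "h s x \<le> 1" for s x
    using g(2) h(2) by auto
  have [measurable]: "g s \<in> borel_measurable borel" "h s \<in> borel_measurable borel" for s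
    using g(1) h(1) by auto
  define C where "C = (\<lambda>s t. LINT z|M. g s (fst z) * h t (snd z))"
  have int[simp]: "integrable M (\<lambda>z. g s (fst z) * h t (snd z))" for s t
  proof (intro integrable_const_bound[where B=1] always_eventually allI)
    show "norm (g s (fst z) * h t (snd z)) \<le> 1" for z
      using gb[of s "fst z"] hb[of t "snd z"] by (simp add: mult_le_one)
  qed measurable
  have C1: "C s 1 = s" "C 1 s = s" "C s 0 = 0" "C 0 s = 0" if "s \<in> {0..1}" for s
    using gi[rule_format, OF that] hi[rule_format, OF that] by (simp_all add: C_def g01 h01 M1_def M2_def integral_distr)
  have rect: "C s t' + C s' t \<le> C s' t' + C s t"
    if "s \<in> {0..1}" "s' \<in> {0..1}" "t \<in> {0..1}" "t' \<in> {0..1}" "s \<le> s'" "t \<le> t'" for s s' t t'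
  proof -
    have "C s t' + C s' t = (LINT z|M. g s (fst z) * h t' (snd z) + g s' (fst z) * h t (snd z))"
      by (simp add: C_def)
    also have "\<dots> \<le> (LINT z|M. g s' (fst z) * h t' (snd z) + g s (fst z) * h t (snd z))"
    proof (intro integral_mono Bochner_Integration.integrable_add int)
      fix z
      have "0 \<le> (g s' (fst z) - g s (fst z)) * (h t' (snd z) - h t (snd z))"
        using gm hm that by (intro mult_nonneg_nonneg) auto
      then show "g s (fst z) * h t' (snd z) + g s' (fst z) * h t (snd z)
          \<le> g s' (fst z) * h t' (snd z) + g s (fst z) * h t (snd z)"
        by (simp add: algebra_simps)
    qed
    finally show ?thesis by (simp add: C_def)
  qed
  have "doubly_substochastic C"
    unfolding doubly_substochastic_def using rect C1 by auto
  then have "copula C" by (rule copulaI) (use C1 in auto)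
  moreover have "G x y = marginal1 G x + marginal2 G y - 1 + C (1 - marginal1 G x) (1 - marginal2 G y)" for x y
  proof -
    let ?i = "\<lambda>z. indicator (fst -` {..x}) z :: real" and ?j = "\<lambda>z. indicator (snd -` {..y}) z :: real"
    have sets: "fst -` {..x} \<in> sets M" "snd -` {..y} \<in> sets M" "{..x} \<times> {..y} \<in> sets M"
      using measurable_sets[OF m(1), of "{..x}"] measurable_sets[OF m(2), of "{..y}"]
      by (auto simp: sp S borel_closed closed_Times)
    have "AE z in M. g (1 - cdf M1 x) (fst z) = 1 - ?i z"
      using AE_distrD[OF m(1) gx[rule_format, of x, unfolded M1_def]] by eventually_elim (simp add: M1_def indicator_def)
    moreover have "AE z in M. h (1 - cdf M2 y) (snd z) = 1 - ?j z"
      using AE_distrD[OF m(2) hx[rule_format, of y, unfolded M2_def]] by eventually_elim (simp add: M2_def indicator_def)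
    ultimately have ae: "AE z in M. g (1 - cdf M1 x) (fst z) * h (1 - cdf M2 y) (snd z)
        = 1 - ?i z - ?j z + indicator ({..x} \<times> {..y}) z"
      by eventually_elim (auto simp: indicator_def)
    have "C (1 - cdf M1 x) (1 - cdf M2 y) = (LINT z|M. 1 - ?i z - ?j z + indicator ({..x} \<times> {..y}) z)"
      unfolding C_def
    proof (rule integral_cong_AE[OF _ _ ae])
      show "(\<lambda>z. 1 - ?i z - ?j z + indicator ({..x} \<times> {..y}) z) \<in> borel_measurable M"
        by (intro borel_measurable_add borel_measurable_diff borel_measurable_indicator borel_measurable_const sets)
    qed measurable
    also have "\<dots> = 1 - measure M (fst -` {..x}) - measure M (snd -` {..y}) + measure M ({..x} \<times> {..y})"
      using sets prob_space unfolding sp by (simp add: less_top[symmetric] sp)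
    finally show ?thesis
      unfolding marg by (simp add: GM bdf_of_def cdf_def M1_def M2_def measure_distr[OF m(1)] measure_distr[OF m(2)] sp)
  qed
  ultimately show thesis by (rule that)
qed

text \<open>The functions from the square to \<open>[0, 1]\<close> form a compact space by Tychonoff's theorem, so the
  sequence has a cluster point. Every defining inequality involves finitely many evaluations and
  hence passes to the cluster point, and so does the limit of every evaluation that converges.\<close>

lemma doubly_substochastic_limit:
  assumes Qn: "\<And>n. doubly_substochastic (Q n)"
  shows "\<exists>Q'. doubly_substochastic Q' \<and>
    (\<forall>s\<in>{0..1}. \<forall>t\<in>{0..1}. \<forall>l. (\<lambda>n. Q n s t) \<longlonglongrightarrow> l \<longrightarrow> Q' s t = l)"
proof -
  define f :: "nat \<Rightarrow> real \<times> real \<Rightarrow> real"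
    where "f = (\<lambda>n (s, t). if s \<in> {0..1} \<and> t \<in> {0..1} then Q n s t else 0)"
  define K where "K = PiE UNIV (\<lambda>_ :: real \<times> real. {0..1::real})"
  have "compactin (product_topology (\<lambda>_. euclidean) UNIV) K"
    unfolding K_def compactin_PiE by (simp add: compactin_euclidean_iff)
  then have K: "compact K" unfolding euclidean_product_topology compactin_euclidean_iff .
  have "f n \<in> K" for n
    using doubly_substochastic_bounds[OF Qn] order_trans[OF doubly_substochastic_bounds(2)[OF Qn]]
    by (auto simp: K_def f_def)
  then have "\<forall>\<^sub>F g in filtermap f sequentially. g \<in> K" by (simp add: eventually_filtermap)
  moreover have "filtermap f sequentially \<noteq> bot" by (simp add: filtermap_bot_iff)
  ultimately obtain q where q: "inf (nhds q) (filtermap f sequentially) \<noteq> bot"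
    using K unfolding compact_filter by blast
  define X where "X = inf (nhds q) (filtermap f sequentially)"
  have X: "X \<noteq> bot" "X \<le> nhds q" "X \<le> filtermap f sequentially" using q by (auto simp: X_def)
  \<comment> \<open>Along \<open>X\<close> the evaluations converge to the values of \<open>q\<close>, and
    every property that all members of the sequence share holds eventually.\<close>
  have eval: "((\<lambda>g. g z) \<longlongrightarrow> q z) X" for z
  proof -
    have "((\<lambda>g. g z) \<longlongrightarrow> q z) (nhds q)"
    proof (rule topological_tendstoI)
      fix S :: "real set" assume S: "open S" "q z \<in> S"
      have c: "continuous_on UNIV (\<lambda>g :: real \<times> real \<Rightarrow> real. g z)" by (rule continuous_on_product_coordinates)
      have "open ((\<lambda>g :: real \<times> real \<Rightarrow> real. g z) -` S)"
        using c[unfolded continuous_on_open_vimage[OF open_UNIV]] S(1) by simp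
      then show "\<forall>\<^sub>F g in nhds q. g z \<in> S"
        using S(2) unfolding eventually_nhds by (intro exI[of _ "(\<lambda>g. g z) -` S"]) auto
    qed
    then show ?thesis by (rule tendsto_mono[OF X(2)])
  qed
  have ev: "eventually P X" if "\<And>n. P (f n)" for P
    using that by (intro filter_leD[OF X(3)]) (simp add: eventually_filtermap)
  have le: "a q \<le> b q" if "(a \<longlongrightarrow> a q) X" "(b \<longlongrightarrow> b q) X" "\<And>n. a (f n) \<le> b (f n)" for a b :: "_ \<Rightarrow> real"
    using tendsto_le[OF X(1) that(2,1) ev] that(3) by blast
  define Q' where "Q' = (\<lambda>s t. q (s, t))"
  have fQ: "f n (s, t) = Q n s t" if "s \<in> {0..1}" "t \<in> {0..1}" for n s t
    using that by (simp add: f_def)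
  have lim: "Q' s t = l" if "s \<in> {0..1}" "t \<in> {0..1}" "(\<lambda>n. Q n s t) \<longlonglongrightarrow> l" for s t l
  proof -
    have "((\<lambda>g. g (s, t)) \<longlongrightarrow> l) (filtermap f sequentially)"
      using that by (simp add: filterlim_filtermap fQ)
    then show ?thesis
      using tendsto_unique[OF X(1) eval tendsto_mono[OF X(3)]] by (auto simp: Q'_def)
  qed
  have zero: "Q' 0 t = 0" "Q' t 0 = 0" if "t \<in> {0..1}" for t
    using lim[of 0 t 0] lim[of t 0 0] that doubly_substochastic_zero[OF Qn, of t] by auto
  have "Q' s' 1 - Q' s 1 \<le> s' - s" "Q' 1 s' - Q' 1 s \<le> s' - s"
    if "s \<in> {0..1}" "s' \<in> {0..1}" "s \<le> s'" for s s'
    unfolding Q'_def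
  proof -
    show "q (s', 1) - q (s, 1) \<le> s' - s"
      by (rule le[of "\<lambda>g. g (s', 1) - g (s, 1)" "\<lambda>_. s' - s"]; (intro tendsto_intros eval)?)
        (use doubly_substochastic_increment1(2)[OF Qn, of s s' 1] that in \<open>simp add: fQ algebra_simps\<close>)
    show "q (1, s') - q (1, s) \<le> s' - s"
      by (rule le[of "\<lambda>g. g (1, s') - g (1, s)" "\<lambda>_. s' - s"]; (intro tendsto_intros eval)?)
        (use doubly_substochastic_increment2(2)[OF Qn, of s s' 1] that in \<open>simp add: fQ algebra_simps\<close>)
  qed
  moreover have "Q' s t' + Q' s' t \<le> Q' s' t' + Q' s t"
    if "s \<in> {0..1}" "s' \<in> {0..1}" "t \<in> {0..1}" "t' \<in> {0..1}" "s \<le> s'" "t \<le> t'" for s s' t t'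
    unfolding Q'_def
    by (rule le[of "\<lambda>g. g (s, t') + g (s', t)" "\<lambda>g. g (s', t') + g (s, t)"]; (intro tendsto_intros eval)?)
      (use doubly_substochastic_rectangle[OF Qn, of s s' t t'] that in \<open>simp add: fQ\<close>)
  ultimately have "doubly_substochastic Q'"
    unfolding doubly_substochastic_def using zero by blast
  moreover have "\<forall>s\<in>{0..1}. \<forall>t\<in>{0..1}. \<forall>l. (\<lambda>n. Q n s t) \<longlonglongrightarrow> l \<longrightarrow> Q' s t = l"
    using lim by blast
  ultimately show ?thesis by (intro exI[of _ Q'] conjI)
qed

section \<open>Infinitely divisible distribution functions are representable\<close>

text \<open>Convolution adds the tails of the marginals and the excesses of the quotients. The positivity of
  \<open>K x y\<close> has to be carried along, since the quotient equation is imposed only where both factors are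
  positive.\<close>

lemma bifree_max_power_quotient:
  assumes "bifree_max_power G n K"
  shows "bivariate_df G \<and> bivariate_df K \<and>
    (\<forall>x. marginal1 K x = max (1 - n * (1 - marginal1 G x)) 0) \<and>
    (\<forall>y. marginal2 K y = max (1 - n * (1 - marginal2 G y)) 0) \<and>
    (\<forall>x y. 0 < G x y \<longrightarrow> 0 < marginal1 K x \<longrightarrow> 0 < marginal2 K y \<longrightarrow>
       0 < K x y \<and> marginal1 K x * marginal2 K y / K x y
         = 1 + n * (marginal1 G x * marginal2 G y / G x y - 1))"
  using assms
proof (induction rule: bifree_max_power.induct)
  case one
  have "0 \<le> marginal1 G x" "0 \<le> marginal2 G x" for x
    using bivariate_df_bounds(1-3)[OF one] by (blast intro: order_trans)+
  then show ?case using one by simp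
next
  case (step n K H)
  have K: "bivariate_df K" and G: "bivariate_df G"
    and K1: "marginal1 K x = max (1 - n * (1 - marginal1 G x)) 0"
    and K2: "marginal2 K x = max (1 - n * (1 - marginal2 G x)) 0"
    and Kq: "0 < G x y \<Longrightarrow> 0 < marginal1 K x \<Longrightarrow> 0 < marginal2 K y \<Longrightarrow>
       0 < K x y \<and> marginal1 K x * marginal2 K y / K x y
         = 1 + n * (marginal1 G x * marginal2 G y / G x y - 1)" for x y
    using step.IH by auto
  have H: "bivariate_df H"
    and H1: "marginal1 H x = max (marginal1 K x + marginal1 G x - 1) 0"
    and H2: "marginal2 H x = max (marginal2 K x + marginal2 G x - 1) 0" for x
    using step.hyps(2) unfolding bifree_max_conv_def by auto
  have "if 0 < K x y \<and> 0 < G x y \<and> 0 < marginal1 H x \<and> 0 < marginal2 H y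
      then marginal1 H x * marginal2 H y / H x y =
               marginal1 K x * marginal2 K y / K x y + marginal1 G x * marginal2 G y / G x y - 1
      else H x y = 0" for x y
    using step.hyps(2) unfolding bifree_max_conv_def by blast
  then have Hq: "0 < K x y \<Longrightarrow> 0 < G x y \<Longrightarrow> 0 < marginal1 H x \<Longrightarrow> 0 < marginal2 H y \<Longrightarrow>
        marginal1 H x * marginal2 H y / H x y =
               marginal1 K x * marginal2 K y / K x y + marginal1 G x * marginal2 G y / G x y - 1" for x y
    by (meson)
  note G1 = bivariate_df_bounds(4,5)[OF G]
  have suc: "Suc n * (1 - g) = n * (1 - g) + (1 - g)" for g :: real by (simp add: algebra_simps)
  have "marginal1 H x = max (1 - Suc n * (1 - marginal1 G x)) 0" for x
    unfolding H1 K1 suc using G1(1)[of x] by auto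
  moreover have "marginal2 H x = max (1 - Suc n * (1 - marginal2 G x)) 0" for x
    unfolding H2 K2 suc using G1(2)[of x] by auto
  moreover have "0 < H x y \<and> marginal1 H x * marginal2 H y / H x y
         = 1 + Suc n * (marginal1 G x * marginal2 G y / G x y - 1)"
    if p: "0 < G x y" "0 < marginal1 H x" "0 < marginal2 H y" for x y
  proof -
    have "0 < marginal1 K x" "0 < marginal2 K y"
      using p(2,3) G1(1)[of x] G1(2)[of y] unfolding H1 H2 by auto
    note k = Kq[OF p(1) this]
    have q: "marginal1 E x \<le> marginal1 E x * marginal2 E y / E x y"
      if "bivariate_df E" "0 < E x y" for E
    proof -
      have "E x y \<le> marginal2 E y" "0 \<le> marginal1 E x"
        using bivariate_df_bounds(1-3)[OF that(1)] by (blast intro: order_trans)+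
      then show ?thesis using that(2) by (simp add: pos_le_divide_eq mult_left_mono)
    qed
    have h: "marginal1 H x * marginal2 H y / H x y =
        marginal1 K x * marginal2 K y / K x y + marginal1 G x * marginal2 G y / G x y - 1"
      using Hq[of x y] k p by blast
    have "0 < marginal1 K x * marginal2 K y / K x y + marginal1 G x * marginal2 G y / G x y - 1"
      using q[OF K] q[OF G p(1)] k p(2) unfolding H1 by auto
    then have "H x y \<noteq> 0" unfolding h[symmetric] by auto
    then have "0 < H x y" using bivariate_df_bounds(1)[OF H, of x y] by simp
    then show ?thesis using k unfolding h by (simp add: distrib_right)
  qed
  ultimately show ?case using G H by blast
qed

theorem substochastic_representation_of_inf_divisible:
  assumes F: "bivariate_df F" and div: "bifree_max_inf_divisible F"
  obtains Q where "doubly_substochastic Q"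
    "\<And>x y. F x y = (if marginal1 F x * marginal2 F y = 0 then 0
       else marginal1 F x * marginal2 F y / (1 - Q (1 - marginal1 F x) (1 - marginal2 F y)))"
proof -
  \<comment> \<open>Roots of order at least 2 are used, because \<open>a / n + b / n < 1\<close> then forces
    the root to be positive wherever both marginals of \<open>F\<close> are.\<close>
  define N :: "nat \<Rightarrow> real" where "N = (\<lambda>k. real (k + 2))"
  have N: "2 \<le> N k" for k by (simp add: N_def)
  have "\<exists>G C. copula C \<and> bifree_max_power G (k + 2) F \<and>
      (\<forall>x y. G x y = marginal1 G x + marginal2 G y - 1 + C (1 - marginal1 G x) (1 - marginal2 G y))" for k
  proof -
    obtain G where "bivariate_df G" "bifree_max_power G (k + 2) F"
      using div unfolding bifree_max_inf_divisible_def by (meson le_add2 one_le_numeral order_trans)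
    then show ?thesis using survival_copula[of G] by metis
  qed
  then obtain G C where C: "\<And>k. copula (C k)" and G: "\<And>k. bifree_max_power (G k) (k + 2) F"
    and GC: "\<And>k x y. G k x y = marginal1 (G k) x + marginal2 (G k) y - 1
        + C k (1 - marginal1 (G k) x) (1 - marginal2 (G k) y)"
    by metis
  define Qn where "Qn = (\<lambda>k s t. N k * C k (min (1 / N k * s) 1) (min (1 / N k * t) 1))"
  have Qn: "doubly_substochastic (Qn k)" for k
    unfolding Qn_def using N[of k]
    by (intro doubly_substochastic_rescale copula_imp_doubly_substochastic C) auto
  have Qn_eq: "Qn k s t = N k * C k (s / N k) (t / N k)" if "s \<in> {0..1}" "t \<in> {0..1}" for k s t
    using that N[of k] by (simp add: Qn_def min_def)
  obtain Q where Q: "doubly_substochastic Q"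
    and lim: "\<forall>s\<in>{0..1}. \<forall>t\<in>{0..1}. \<forall>l. (\<lambda>k. Qn k s t) \<longlonglongrightarrow> l \<longrightarrow> Q s t = l"
    using doubly_substochastic_limit[of Qn, OF Qn] by (elim exE conjE)
  have N_lim: "(\<lambda>k. c / N k) \<longlonglongrightarrow> 0" for c
    unfolding N_def by (rule LIMSEQ_ignore_initial_segment[OF lim_const_over_n])
  show thesis
  proof (rule that[OF Q])
    fix x y
    note Fb = bivariate_df_bounds(1-3)[OF F, of x y] bivariate_df_bounds(4,5)[OF F]
    define f g where "f = marginal1 F x" and "g = marginal2 F y"
    define a b where "a = 1 - f" and "b = 1 - g"
    have fg: "0 \<le> f" "f \<le> 1" "0 \<le> g" "g \<le> 1"
      using order_trans[OF Fb(1,2)] order_trans[OF Fb(1,3)] Fb(4,5) by (auto simp: f_def g_def)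
    show "F x y = (if marginal1 F x * marginal2 F y = 0 then 0
       else marginal1 F x * marginal2 F y / (1 - Q (1 - marginal1 F x) (1 - marginal2 F y)))"
    proof (cases "f = 0 \<or> g = 0")
      case True
      then show ?thesis using Fb by (auto simp: f_def g_def)
    next
      case False
      then have pos: "0 < f" "0 < g" using fg by auto
      have ab: "a \<in> {0..1}" "b \<in> {0..1}" "a < 1" "b < 1" using fg pos by (auto simp: a_def b_def)
      define r where "r = f * g / F x y - 1"
      \<comment> \<open>The last equation is the quotient equation of the root, solved for its rescaled
        survival copula.\<close>
      have *: "0 < G k x y \<and> 0 < F x y \<and> G k x y = 1 - a / N k - b / N k + Qn k a b / N k \<and>
          Qn k a b = a * b / N k - G k x y * r" for k
      proof -
        have Nk: "real (k + 2) = N k" by (simp add: N_def)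
        note P = bifree_max_power_quotient[OF G[of k], unfolded Nk]
        have "f = max (1 - N k * (1 - marginal1 (G k) x)) 0" "g = max (1 - N k * (1 - marginal2 (G k) y)) 0"
          using P by (auto simp: f_def g_def)
        then have m: "marginal1 (G k) x = 1 - a / N k" "marginal2 (G k) y = 1 - b / N k"
          using pos N[of k] by (auto simp: a_def b_def field_simps max_def split: if_splits)
        have GQ: "G k x y = 1 - a / N k - b / N k + Qn k a b / N k"
          using GC[of k x y] N[of k] by (simp add: m Qn_eq[OF ab(1,2)])
        have "a / N k < 1 / 2" "b / N k < 1 / 2" using ab N[of k] by (auto simp: field_simps)
        moreover have "0 \<le> Qn k a b / N k"
          using doubly_substochastic_bounds(1)[OF Qn, of a b k] ab N[of k] by auto
        ultimately have Gpos: "0 < G k x y" unfolding GQ by linarith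
        have "0 < F x y \<and> f * g / F x y = 1 + N k * ((1 - a / N k) * (1 - b / N k) / G k x y - 1)"
          using P Gpos pos unfolding f_def g_def m[symmetric] by blast
        then have "0 < F x y" and "r = N k * ((1 - a / N k) * (1 - b / N k) / G k x y - 1)"
          by (auto simp: r_def)
        then have "G k x y * r = N k * ((1 - a / N k) * (1 - b / N k) - G k x y)"
          using Gpos by (simp add: field_simps)
        also have "\<dots> = a * b / N k - Qn k a b"
          using N[of k] unfolding GQ by (simp add: field_simps)
        finally show ?thesis using Gpos \<open>0 < F x y\<close> GQ by simp
      qed
      have "(\<lambda>k. Qn k a b / N k) \<longlonglongrightarrow> 0"
      proof (rule tendsto_sandwich[OF _ _ tendsto_const N_lim[of 1]])
        have "0 \<le> Qn k a b / N k \<and> Qn k a b / N k \<le> 1 / N k" for k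
          using doubly_substochastic_bounds[OF Qn, of a b k] ab N[of k] by (auto intro: divide_right_mono)
        then show "\<forall>\<^sub>F k in sequentially. 0 \<le> Qn k a b / N k"
          "\<forall>\<^sub>F k in sequentially. Qn k a b / N k \<le> 1 / N k" by auto
      qed
      then have "(\<lambda>k. 1 - a / N k - b / N k + Qn k a b / N k) \<longlonglongrightarrow> 1 - 0 - 0 + 0"
        by (intro tendsto_intros N_lim)
      moreover have "(\<lambda>k. G k x y) = (\<lambda>k. 1 - a / N k - b / N k + Qn k a b / N k)"
        by (rule ext) (use * in blast)
      ultimately have "(\<lambda>k. G k x y) \<longlonglongrightarrow> 1" by simp
      then have "(\<lambda>k. a * b / N k - G k x y * r) \<longlonglongrightarrow> 0 - 1 * r"
        by (intro tendsto_intros N_lim)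
      moreover have "(\<lambda>k. a * b / N k - G k x y * r) = (\<lambda>k. Qn k a b)"
        by (rule ext) (metis *)
      ultimately have "Q a b = - r" using lim ab(1,2) by simp
      moreover have "0 < F x y" using * by blast
      ultimately show ?thesis using pos by (simp add: r_def a_def b_def f_def g_def)
    qed
  qed
qed

section \<open>Represented distribution functions are infinitely divisible\<close>

lemma marginal_real_distribution:
  assumes "bivariate_df F"
  obtains M1 M2 where "real_distribution M1" "real_distribution M2"
    "marginal1 F = cdf M1" "marginal2 F = cdf M2"
proof -
  obtain M where M: "prob_space M" and S: "sets M = sets (borel :: (real \<times> real) measure)"
    and F: "F = bdf_of M"
    using assms unfolding bivariate_df_def by blast
  interpret prob_space M by fact
  have m: "fst \<in> borel_measurable M" "snd \<in> borel_measurable M"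
    using measurable_cong_sets[OF S refl] by (auto simp: borel_prod[symmetric])
  show thesis
    by (rule that[OF real_distribution_distr[OF m(1)] real_distribution_distr[OF m(2)]])
      (simp_all add: F marginal_bdf_of[OF M S])
qed

text \<open>For a law \<open>M\<close> on \<open>[L, \<infinity>)\<close> this is the mixture of \<open>M\<close> with weight \<open>k\<close> and the point mass at \<open>L\<close>.\<close>

lemma cdf_mixture_with_lower_endpoint:
  fixes M :: "real measure"
  assumes M: "real_distribution M" and k: "0 \<le> k" "k \<le> 1"
  obtains M' :: "real measure" where "real_distribution M'"
    "cdf M' = (\<lambda>x. if x < L then 0 else 1 - k * (1 - cdf M x))"
proof -
  interpret M: real_distribution M by fact
  define h where "h = (\<lambda>x. if x < L then 0 else 1 - k * (1 - cdf M x))"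
  have b: "0 \<le> 1 - k * (1 - cdf M x)" for x
    using mult_mono[of k 1 "1 - cdf M x" 1] k M.cdf_nonneg[of x] M.cdf_bounded_prob[of x] by auto
  have 1: "h x \<le> h y" if "x \<le> y" for x y
    using b[of y] M.cdf_nondecreasing[OF that] that k by (auto simp: h_def intro!: mult_left_mono)
  have 2: "continuous (at_right a) h" for a
  proof (cases "a < L")
    case True
    then have "\<forall>\<^sub>F x in at_right a. 0 = h x"
      unfolding eventually_at_right_field by (intro exI[of _ L]) (auto simp: h_def)
    then have "(h \<longlongrightarrow> 0) (at_right a)" by (rule Lim_transform_eventually[rotated]) simp
    then show ?thesis using True by (simp add: continuous_within h_def)
  next
    case False
    have "((\<lambda>x. 1 - k * (1 - cdf M x)) \<longlongrightarrow> h a) (at_right a)"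
      using M.cdf_is_right_cont[of a] False unfolding continuous_within h_def by (auto intro!: tendsto_intros)
    moreover have "\<forall>\<^sub>F x in at_right a. 1 - k * (1 - cdf M x) = h x"
      unfolding eventually_at_right_field using False by (intro exI[of _ "a + 1"]) (auto simp: h_def)
    ultimately show ?thesis unfolding continuous_within by (rule Lim_transform_eventually)
  qed
  have 3: "(h \<longlongrightarrow> 0) at_bot"
  proof (rule Lim_transform_eventually[OF tendsto_const])
    show "\<forall>\<^sub>F x in at_bot. 0 = h x"
      unfolding eventually_at_bot_linorder by (intro exI[of _ "L - 1"]) (auto simp: h_def)
  qed
  have 4: "(h \<longlongrightarrow> 1) at_top"
  proof (rule Lim_transform_eventually)
    show "((\<lambda>x. 1 - k * (1 - cdf M x)) \<longlongrightarrow> 1) at_top"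
      using M.cdf_lim_at_top_prob by (auto intro!: tendsto_eq_intros)
    show "\<forall>\<^sub>F x in at_top. 1 - k * (1 - cdf M x) = h x"
      unfolding eventually_at_top_linorder by (intro exI[of _ L]) (auto simp: h_def)
  qed
  have "cdf (interval_measure h) = h" using 1 2 3 by (rule cdf_interval_measure)
  then show thesis
    by (intro that[OF real_distribution_interval_measure[OF 1 2 3 4]]) (simp_all add: h_def)
qed

text \<open>The candidates \<open>K k\<close> for fractional powers of \<open>F\<close> form a convolution semigroup. Only a
  finite lower end of the support gives the missing mass \<open>1 - k\<close> of the marginals a place to sit; for
  unbounded supports it would escape to \<open>-\<infinity>\<close>.\<close>

theorem inf_divisible_of_substochastic_representation:
  assumes F: "bivariate_df F"
    and L1: "support_bdd_below (marginal1 F)" and L2: "support_bdd_below (marginal2 F)"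
    and Q: "doubly_substochastic Q"
    and FQ: "\<And>x y. F x y = (if marginal1 F x * marginal2 F y = 0 then 0
       else marginal1 F x * marginal2 F y / (1 - Q (1 - marginal1 F x) (1 - marginal2 F y)))"
  shows "bifree_max_inf_divisible F"
proof -
  obtain M1 M2 where M: "real_distribution M1" "real_distribution M2"
    and marg: "marginal1 F = cdf M1" "marginal2 F = cdf M2"
    using marginal_real_distribution[OF F] by blast
  interpret M1: real_distribution M1 by fact
  interpret M2: real_distribution M2 by fact
  define A B where "A = (\<lambda>x. 1 - cdf M1 x)" and "B = (\<lambda>y. 1 - cdf M2 y)"
  have AB: "0 \<le> A x" "A x \<le> 1" "0 \<le> B x" "B x \<le> 1" for x
    using M1.cdf_nonneg M2.cdf_nonneg M1.cdf_bounded_prob M2.cdf_bounded_prob by (auto simp: A_def B_def)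
  obtain l m where l: "{x. cdf M1 x > 0} \<subseteq> {l..}" and m: "{x. cdf M2 x > 0} \<subseteq> {m..}"
    using L1 L2 unfolding support_bdd_below_def marg by blast
  define f g where "f = (\<lambda>k x. if x < l then 0 else 1 - k * A x)" and "g = (\<lambda>k y. if y < m then 0 else 1 - k * B y)"
  define K where "K = (\<lambda>k x y. f k x * g k y / (1 - k * Q (A x) (B y)))"
  have fg0: "0 \<le> f k x" "0 \<le> g k x" if "0 < k" "k \<le> 1" for k x
    using mult_mono[of k 1 "A x" 1] mult_mono[of k 1 "B x" 1] that AB[of x] by (auto simp: f_def g_def)
  have K: "bivariate_df (K k)" "marginal1 (K k) = f k" "marginal2 (K k) = g k" if k: "0 < k" "k \<le> 1" for k
  proof -
    obtain N1 where N1: "real_distribution N1" "cdf N1 = f k"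
      using cdf_mixture_with_lower_endpoint[OF M(1) less_imp_le[OF k(1)] k(2), of l]
      unfolding f_def A_def by blast
    obtain N2 where N2: "real_distribution N2" "cdf N2 = g k"
      using cdf_mixture_with_lower_endpoint[OF M(2) less_imp_le[OF k(1)] k(2), of m]
      unfolding g_def B_def by blast
    \<comment> \<open>At \<open>s = k a\<close>, \<open>t = k b\<close> with \<open>a, b \<le> 1\<close>
      this is \<open>k Q(a, b)\<close>; the truncation extends it to the whole square.\<close>
    define R where "R = (\<lambda>s t. k * Q (min (1 / k * s) 1) (min (1 / k * t) 1))"
    have "doubly_substochastic R"
      unfolding R_def using k by (intro doubly_substochastic_rescale[OF Q]) auto
    then have C: "copula (\<lambda>u v. u * v / (1 - R (1 - u) (1 - v)))" (is "copula ?C")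
      by (rule product_over_survival_copula)
    have "K k x y = ?C (cdf N1 x) (cdf N2 y)" for x y
      using k AB(2)[of x] AB(4)[of y] unfolding N1 N2 by (simp add: K_def f_def g_def R_def min_def)
    then have "K k = (\<lambda>x y. ?C (cdf N1 x) (cdf N2 y))" by (auto simp: fun_eq_iff)
    then show "bivariate_df (K k)" "marginal1 (K k) = f k" "marginal2 (K k) = g k"
      using bivariate_df_copula[OF C N1(1) N2(1)] N1(2) N2(2) by auto
  qed
  have pos: "0 < 1 - k * Q (A x) (B y) \<and> 0 < K k x y" if k: "0 < k" "k \<le> 1" and fg: "0 < f k x" "0 < g k y" for k x y
  proof -
    have "k * Q (A x) (B y) \<le> k * A x"
      using doubly_substochastic_bounds(2)[OF Q, of "A x" "B y"] AB k by (intro mult_left_mono) auto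
    also have "\<dots> < 1" using fg(1) by (auto simp: f_def split: if_splits)
    finally show ?thesis using fg by (simp add: K_def)
  qed
  have conv: "bifree_max_conv (K k) (K k') (K (k + k'))" if k: "0 < k" "0 < k'" "k + k' \<le> 1" for k k'
  proof -
    have k1: "k \<le> 1" "k' \<le> 1" using k by auto
    have dec: "f k x \<le> 1" "g k x \<le> 1" if "0 < k" for k x using AB[of x] that by (auto simp: f_def g_def)
    have f: "f (k + k') x = max (f k x + f k' x - 1) 0" for x
      using fg0(1)[of "k + k'" x] k by (auto simp: f_def algebra_simps)
    have g: "g (k + k') x = max (g k x + g k' x - 1) 0" for x
      using fg0(2)[of "k + k'" x] k by (auto simp: g_def algebra_simps)
    have q: "if K k x y > 0 \<and> K k' x y > 0 \<and> f (k + k') x > 0 \<and> g (k + k') y > 0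
        then f (k + k') x * g (k + k') y / K (k + k') x y =
               f k x * g k y / K k x y + f k' x * g k' y / K k' x y - 1
        else K (k + k') x y = 0" for x y
    proof (cases "f (k + k') x > 0 \<and> g (k + k') y > 0")
      case False
      then have "f (k + k') x = 0 \<or> g (k + k') y = 0" using fg0[of "k + k'"] k by (auto simp: less_le)
      then have "K (k + k') x y = 0" by (auto simp: K_def)
      then show ?thesis using False by auto
    next
      case True
      then have p: "0 < f k x" "0 < f k' x" "0 < g k y" "0 < g k' y"
        using dec[OF k(1), of x] dec[OF k(1), of y] dec[OF k(2), of x] dec[OF k(2), of y] unfolding f g by auto
      have e: "f j x * g j y / K j x y = 1 - j * Q (A x) (B y)"
        if "0 < j" "j \<le> 1" "0 < f j x" "0 < g j y" for j
        using pos[OF that] that by (simp add: K_def)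
      have eq: "f (k + k') x * g (k + k') y / K (k + k') x y =
          f k x * g k y / K k x y + f k' x * g k' y / K k' x y - 1"
        unfolding e[OF k(1) k1(1) p(1,3)] e[OF k(2) k1(2) p(2,4)]
        using e[of "k + k'"] True k by (simp add: distrib_right)
      show ?thesis
        using eq True pos[OF k(1) k1(1) p(1,3)] pos[OF k(2) k1(2) p(2,4)] by simp
    qed
    have kk: "0 < k + k'" using k by simp
    show ?thesis
      unfolding bifree_max_conv_def K(2,3)[OF k(1) k1(1)] K(2,3)[OF k(2) k1(2)] K(2,3)[OF kk k(3)]
      using K(1)[OF k(1) k1(1)] K(1)[OF k(2) k1(2)] K(1)[OF kk k(3)] f g q by blast
  qed
  have K1: "K 1 = F"
  proof (intro ext)
    fix x y
    have "f 1 x = cdf M1 x" "g 1 y = cdf M2 y"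
      using l m M1.cdf_nonneg[of x] M2.cdf_nonneg[of y] by (fastforce simp: f_def g_def A_def B_def less_le)+
    then show "K 1 x y = F x y" by (auto simp: K_def FQ marg A_def B_def)
  qed
  show ?thesis
    unfolding bifree_max_inf_divisible_def
  proof (intro allI impI)
    fix n :: nat assume n: "1 \<le> n"
    have "k \<le> n \<longrightarrow> bifree_max_power (K (1 / n)) k (K (k / n))" if "1 \<le> k" for k
      using that
    proof (induction k rule: nat_induct_at_least)
      case base
      show ?case using bifree_max_power.one[OF K(1)[of "1 / n"]] n by simp
    next
      case (Suc k)
      show ?case
      proof
        assume k: "Suc k \<le> n"
        have e: "real (Suc k) / n = k / n + 1 / n" by (simp add: add_divide_distrib)
        have "bifree_max_conv (K (k / n)) (K (1 / n)) (K (Suc k / n))"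
          unfolding e using Suc.hyps k by (intro conv) (auto simp: field_simps)
        then show "bifree_max_power (K (1 / n)) (Suc k) (K (Suc k / n))"
          using Suc k by (intro bifree_max_power.step) auto
      qed
    qed
    from this[OF n] have "bifree_max_power (K (1 / n)) n F" using n by (simp add: K1)
    moreover have "bivariate_df (K (1 / n))" using n by (intro K(1)) auto
    ultimately show "\<exists>G. bivariate_df G \<and> bifree_max_power G n F" by blast
  qed
qed

section \<open>The copula representation\<close>

theorem theorem5p2:
  fixes F :: "real \<Rightarrow> real \<Rightarrow> real"
  assumes "bivariate_df F"
    and "support_bdd_below (marginal1 F)" and "support_bdd_below (marginal2 F)"
  shows "bifree_max_inf_divisible F \<longleftrightarrow>
    (\<exists>D \<theta>. copula D \<and> 0 < \<theta> \<and> \<theta> \<le> 1 \<and>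
      (\<forall>x1 x2. F x1 x2 =
        (if marginal1 F x1 * marginal2 F x2 = 0 then 0
         else \<theta> * marginal1 F x1 * marginal2 F x2 /
                (\<theta> - D (\<theta> * (1 - marginal1 F x1)) (\<theta> * (1 - marginal2 F x2))))))"
proof -
  note b = bivariate_df_bounds[OF assms(1)]
  have unit: "1 - marginal1 F x \<in> {0..1}" "1 - marginal2 F x \<in> {0..1}" for x
    using order_trans[OF b(1) b(2)] order_trans[OF b(1) b(3)] b(4,5) by auto
  have scale: "\<theta> * u * v / (\<theta> - d) = u * v / (1 - d / \<theta>)" if "0 < \<theta>" for \<theta> u v d :: real
  proof -
    have "\<theta> - d = \<theta> * (1 - d / \<theta>)" using that by (simp add: right_diff_distrib)
    then show ?thesis using that by (simp add: mult.assoc)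
  qed
  show ?thesis
  proof
    assume "bifree_max_inf_divisible F"
    then obtain Q where Q: "doubly_substochastic Q"
      and FQ: "\<And>x y. F x y = (if marginal1 F x * marginal2 F y = 0 then 0
       else marginal1 F x * marginal2 F y / (1 - Q (1 - marginal1 F x) (1 - marginal2 F y)))"
      using substochastic_representation_of_inf_divisible[OF assms(1)] by blast
    obtain D where D: "copula D"
      and DQ: "\<And>s t. s \<in> {0..1} \<Longrightarrow> t \<in> {0..1} \<Longrightarrow> D (s / 2) (t / 2) = Q s t / 2"
      using doubly_substochastic_extends_to_copula[OF Q] by blast
    have "F x1 x2 = (if marginal1 F x1 * marginal2 F x2 = 0 then 0
         else 1 / 2 * marginal1 F x1 * marginal2 F x2 /
                (1 / 2 - D (1 / 2 * (1 - marginal1 F x1)) (1 / 2 * (1 - marginal2 F x2))))" for x1 x2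
      using FQ[of x1 x2] DQ[OF unit, of x1 x2] scale[of "1 / 2"] by simp
    then show "\<exists>D \<theta>. copula D \<and> 0 < \<theta> \<and> \<theta> \<le> 1 \<and>
      (\<forall>x1 x2. F x1 x2 =
        (if marginal1 F x1 * marginal2 F x2 = 0 then 0
         else \<theta> * marginal1 F x1 * marginal2 F x2 /
                (\<theta> - D (\<theta> * (1 - marginal1 F x1)) (\<theta> * (1 - marginal2 F x2)))))"
      using D by (intro exI[of _ D] exI[of _ "1 / 2"]) auto
  next
    assume "\<exists>D \<theta>. copula D \<and> 0 < \<theta> \<and> \<theta> \<le> 1 \<and>
      (\<forall>x1 x2. F x1 x2 =
        (if marginal1 F x1 * marginal2 F x2 = 0 then 0
         else \<theta> * marginal1 F x1 * marginal2 F x2 /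
                (\<theta> - D (\<theta> * (1 - marginal1 F x1)) (\<theta> * (1 - marginal2 F x2)))))"
    then obtain D \<theta> where D: "copula D" "0 < \<theta>" "\<theta> \<le> 1"
      and FD: "\<And>x1 x2. F x1 x2 = (if marginal1 F x1 * marginal2 F x2 = 0 then 0
         else \<theta> * marginal1 F x1 * marginal2 F x2 /
                (\<theta> - D (\<theta> * (1 - marginal1 F x1)) (\<theta> * (1 - marginal2 F x2))))"
      by blast
    \<comment> \<open>The truncation at 1 is void on the unit square; it matches the form of the rescaling
      lemma.\<close>
    define Q where "Q = (\<lambda>s t. 1 / \<theta> * D (min (\<theta> * s) 1) (min (\<theta> * t) 1))"
    have "doubly_substochastic Q"
      unfolding Q_def using D by (intro doubly_substochastic_rescale copula_imp_doubly_substochastic) auto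
    moreover have Q_eq: "Q s t = D (\<theta> * s) (\<theta> * t) / \<theta>" if "s \<in> {0..1}" "t \<in> {0..1}" for s t
      using that D mult_mono[of \<theta> 1 s 1] mult_mono[of \<theta> 1 t 1] by (simp add: Q_def min_absorb1)
    have "F x y = (if marginal1 F x * marginal2 F y = 0 then 0
       else marginal1 F x * marginal2 F y / (1 - Q (1 - marginal1 F x) (1 - marginal2 F y)))" for x y
      using FD[of x y] unfolding scale[OF D(2)] Q_eq[OF unit] .
    ultimately show "bifree_max_inf_divisible F"
      using inf_divisible_of_substochastic_representation[OF assms] by blast
  qed
qed

end
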